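(* Let $N\ge 2$ and let $(S_i)_{i\in\mathbb{Z}_N}$ be a representation of the Cuntz algebra $\mathcal{O}_N$ on a Hilbert space $\mathcal{H}$. For every finite word $I$ over $\mathbb{Z}_N$ define the projection $P(\mathcal{C}(I))=S_IS_I^*$. Then $P$ extends to a projection-valued measure on the Borel sigma-algebra $\mathcal{B}(\mathcal{K})$ of $\mathcal{K}=\mathcal{K}_N$. For $\xi=\xi_1\dots\xi_n00\dots\in\widehat{\mathcal{K}}$ define $$U(\xi)=\sum_{I\in\mathbb{Z}_N^n}\langle I,\xi\rangle S_IS_I^*.$$ Then $U$ defines a unitary representation of the group $\widehat{\mathcal{K}}$ on $\mathcal{H}$, and $P$ is the spectral decomposition of $U$, i.e., $$U(\xi)=\int_{\mathcal{K}}\langle\omega,\xi\rangle\,P(d\omega),\qquad(\xi\in\widehat{\mathcal{K}}).$$ For all $i\in\mathbb{Z}_N$ and $A\in\mathcal{B}(\mathcal{K})$, $$S_iP(A)S_i^*=P(\sigma_i(A)),\qquad \sum_{j\in\mathbb{Z}_N}S_jP(\sigma_j^{-1}(A))S_j^*=P(A).$$ Define $\alpha:B(\mathcal{H})\to B(\mathcal{H})$ by $\alpha(T)=\sum_{i=0}^{N-1}S_iTS_i^*$. Then $\alpha$ is an endomorphism of $B(\mathcal{H})$ and $$\alpha(P(A))=P(\sigma^{-1}(A)),\qquad(A\in\mathcal{B}(\mathcal{K})).$$ For every bounded measurable function $f$ on $\mathcal{K}$, $$\alpha\left(\int_{\mathcal{K}} f(\omega)\,dP(\omega)\right)=\int_{\mathcal{K}}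 f(\sigma(\omega))\,dP(\omega).$$ Also $\alpha(U(\xi))=U(\widehat\sigma(\xi))$ for all $\xi\in\widehat{\mathcal{K}}$.
   Context: $\mathbb{Z}_N=\{0,1,\dots,N-1\}$. A representation of the Cuntz algebra $\mathcal{O}_N$ on a Hilbert space $\mathcal{H}$ is a family $(S_i)_{i\in\mathbb{Z}_N}$ of bounded operators on $\mathcal{H}$ with $S_i^*S_j=\delta_{ij}I$ for all $i,j\in\mathbb{Z}_N$ and $\sum_{i\in\mathbb{Z}_N}S_iS_i^*=I$. For a finite word $I=i_1\dots i_n$, $S_I:=S_{i_1}\cdots S_{i_n}$ ($S_\emptyset$ is the identity). $\mathcal{K}=\mathcal{K}_N=\prod_{1}^\infty\mathbb{Z}_N$ is the compact group of infinite words $\omega=\omega_1\omega_2\dots$, with the product topology and $\mathcal{B}(\mathcal{K})$ its Borel sigma-algebra. The cylinder set of $I=i_1\dots i_k$ is $\mathcal{C}(I)=\{\omega\in\mathcal{K}:\omega_1=i_1,\dots,\omega_k=i_k\}$. The shift is $\sigma(\omega_1\omega_2\dots)=\omega_2\omega_3\dots$ and its inverse branches are $\sigma_i(\omega_1\omega_2\dots)=i\omega_1\omega_2\dots$, $i\in\mathbb{Z}_N$. The dual group of $\mathcal{K}$ is $\widehat{\mathcal{K}}=\{\xi_1\xi_2\dots\xi_p00\dots:\xi_1,\dots,\xi_p\in\mathbb{Z}_N,\ p\in\mathbb{N}\}$ (componentwise addition mod $N$), with duality $\langle\omega,\xi\rangle=\prod_{k=1}^\infty e^{2\pi i\omega_k\xi_k/N}$.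 For $\xi=\xi_1\dots\xi_n00\dots$ and $I\in\mathbb{Z}_N^n$, $\langle I,\xi\rangle:=\langle I00\dots,\xi\rangle$. The dual shift is $\widehat\sigma(\xi_1\dots\xi_p00\dots)=0\xi_1\dots\xi_p00\dots$. *)

theory Defs
  imports "HOL-Analysis.Analysis" "HOL-Algebra.Group"
begin

section \<open>Complex Hilbert spaces and their bounded operators\<close>

text \<open>The inner product is linear in the first argument. The norm and the topology are those
  of the underlying real inner product space, whose inner product is the real part of the
  complex one.\<close>

class complex_inner = real_inner +
  fixes scaleC :: "complex \<Rightarrow> 'a \<Rightarrow> 'a"  (infixr "*\<^sub>C" 75)
    and cinner :: "'a \<Rightarrow> 'a \<Rightarrow> complex"
  assumes scaleC_add_right: "c *\<^sub>C (x + y) = c *\<^sub>C x + c *\<^sub>C y"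
    and scaleC_add_left: "(c + d) *\<^sub>C x = c *\<^sub>C x + d *\<^sub>C x"
    and scaleC_scaleC: "c *\<^sub>C d *\<^sub>C x = (c * d) *\<^sub>C x"
    and scaleC_of_real: "complex_of_real r *\<^sub>C x = r *\<^sub>R x"
    and cinner_commute: "cinner x y = cnj (cinner y x)"
    and cinner_add_left: "cinner (x + y) z = cinner x z + cinner y z"
    and cinner_scaleC_left: "cinner (c *\<^sub>C x) y = c * cinner x y"
    and inner_eq_Re_cinner: "inner x y = Re (cinner x y)"

class chilbert_space = complex_inner + complete_space

lemma norm_scaleC: "norm (c *\<^sub>C x) = cmod c * norm (x :: 'a::complex_inner)"
proof -
  have r: "cinner (c *\<^sub>C x) (c *\<^sub>C x) = (c * cnj c) * cinner x x"
  proof -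
    have "cinner (c *\<^sub>C x) (c *\<^sub>C x) = c * cnj (c * cinner x x)"
      by (metis cinner_commute cinner_scaleC_left)
    also have "\<dots> = (c * cnj c) * cinner x x"
      by (metis cinner_commute complex_cnj_mult mult.assoc)
    finally show ?thesis .
  qed
  have "inner (c *\<^sub>C x) (c *\<^sub>C x) = (cmod c)\<^sup>2 * inner x x"
    unfolding inner_eq_Re_cinner r complex_norm_square[symmetric] by simp
  then show ?thesis
    by (simp add: norm_eq_sqrt_inner real_sqrt_mult)
qed

lemma bounded_linear_scaleC: "bounded_linear (\<lambda>x. c *\<^sub>C (x :: 'a::complex_inner))"
proof (rule bounded_linear_intro[where K = "cmod c"])
  show "c *\<^sub>C (r *\<^sub>R x) = r *\<^sub>R (c *\<^sub>C x)" for r and x :: 'a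
    by (simp flip: scaleC_of_real add: scaleC_scaleC mult.commute)
qed (simp_all add: scaleC_add_right norm_scaleC mult.commute)

text \<open>A \<open>blinfun\<close> is only real-linear; \<open>bounded_ops\<close> is \<open>B(H)\<close>, with composition
  \<open>o\<^sub>L\<close> as product.\<close>

definition bounded_ops :: "('a::complex_inner \<Rightarrow>\<^sub>L 'a) set" where
  "bounded_ops = {T. \<forall>c x. blinfun_apply T (c *\<^sub>C x) = c *\<^sub>C blinfun_apply T x}"

lift_definition scale_op :: "complex \<Rightarrow> ('a::complex_inner \<Rightarrow>\<^sub>L 'a) \<Rightarrow> ('a \<Rightarrow>\<^sub>L 'a)"
  is "\<lambda>c T x. c *\<^sub>C T x"
  by (rule bounded_linear_compose[OF bounded_linear_scaleC])

definition is_adj :: "('a::complex_inner \<Rightarrow>\<^sub>L 'a) \<Rightarrow> ('a \<Rightarrow>\<^sub>L 'a) \<Rightarrow> bool" where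
  "is_adj T T' \<longleftrightarrow>
     (\<forall>x y. cinner (blinfun_apply T x) y = cinner x (blinfun_apply T' y))"

definition adj :: "('a::complex_inner \<Rightarrow>\<^sub>L 'a) \<Rightarrow> ('a \<Rightarrow>\<^sub>L 'a)" where
  "adj T = (THE T'. is_adj T T')"

lemma is_adj_unique:
  assumes "is_adj T T1" and "is_adj T T2"
  shows "T1 = T2"
proof (rule blinfun_eqI)
  fix y
  have "inner x (blinfun_apply T1 y) = inner x (blinfun_apply T2 y)" for x
    using assms unfolding is_adj_def inner_eq_Re_cinner by metis
  then show "blinfun_apply T1 y = blinfun_apply T2 y"
    by (metis inner_diff_right inner_eq_zero_iff right_minus_eq)
qed

definition projection_op :: "('a::complex_inner \<Rightarrow>\<^sub>L 'a) \<Rightarrow> bool" where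
  "projection_op E \<longleftrightarrow> E \<in> bounded_ops \<and> E o\<^sub>L E = E \<and> adj E = E"

definition unitary_group :: "('a::complex_inner \<Rightarrow>\<^sub>L 'a) monoid" where
  "unitary_group =
     \<lparr>carrier = {V \<in> bounded_ops. adj V o\<^sub>L V = id_blinfun \<and> V o\<^sub>L adj V = id_blinfun},
      mult = (o\<^sub>L), one = id_blinfun\<rparr>"

text \<open>Endomorphisms of \<open>B(H)\<close> are taken in the sense of operator algebras: unital and
  adjoint-preserving.\<close>

definition endomorphism_ops ::
    "(('a::complex_inner \<Rightarrow>\<^sub>L 'a) \<Rightarrow> ('a \<Rightarrow>\<^sub>L 'a)) \<Rightarrow> bool" where
  "endomorphism_ops \<phi> \<longleftrightarrow>
     (\<forall>T\<in>bounded_ops. \<phi> T \<in> bounded_ops) \<and>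
     (\<forall>T\<in>bounded_ops. \<forall>R\<in>bounded_ops. \<phi> (T + R) = \<phi> T + \<phi> R) \<and>
     (\<forall>c. \<forall>T\<in>bounded_ops. \<phi> (scale_op c T) = scale_op c (\<phi> T)) \<and>
     (\<forall>T\<in>bounded_ops. \<forall>R\<in>bounded_ops. \<phi> (T o\<^sub>L R) = \<phi> T o\<^sub>L \<phi> R) \<and>
     (\<forall>T\<in>bounded_ops. \<phi> (adj T) = adj (\<phi> T)) \<and>
     \<phi> id_blinfun = id_blinfun"


section \<open>Projection-valued measures\<close>

text \<open>Countable additivity is convergence in the strong operator topology.\<close>

definition pvm :: "'w measure \<Rightarrow> ('w set \<Rightarrow> ('a::complex_inner \<Rightarrow>\<^sub>L 'a)) \<Rightarrow> bool" where
  "pvm M P \<longleftrightarrow>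
     (\<forall>A\<in>sets M. projection_op (P A)) \<and>
     P {} = 0 \<and> P (space M) = id_blinfun \<and>
     (\<forall>A\<in>sets M. \<forall>B\<in>sets M. P (A \<inter> B) = P A o\<^sub>L P B) \<and>
     (\<forall>A :: nat \<Rightarrow> 'w set. range A \<subseteq> sets M \<longrightarrow> disjoint_family A \<longrightarrow>
        (\<forall>x. (\<lambda>n. blinfun_apply (P (A n)) x) sums blinfun_apply (P (\<Union>n. A n)) x))"

text \<open>The finite positive measure \<open>A \<mapsto> \<langle>P(A)x, x\<rangle>\<close>; this number is real and nonnegative
  because \<open>P(A)\<close> is a projection.\<close>

definition pvm_measure ::
    "'w measure \<Rightarrow> ('w set \<Rightarrow> ('a::complex_inner \<Rightarrow>\<^sub>L 'a)) \<Rightarrow> 'a \<Rightarrow> 'w measure" where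
  "pvm_measure M P x =
     measure_of (space M) (sets M) (\<lambda>A. ennreal (Re (cinner (blinfun_apply (P A) x) x)))"

text \<open>The integral of a bounded measurable function against \<open>P\<close> is the bounded operator \<open>T\<close>
  with \<open>\<langle>Tx, x\<rangle> = \<integral> f(\<omega>) \<langle>P(d\<omega>)x, x\<rangle>\<close> for all \<open>x\<close>. By polarization this is the same as
  \<open>\<langle>Tx, y\<rangle> = \<integral> f(\<omega>) \<langle>P(d\<omega>)x, y\<rangle>\<close> for all \<open>x\<close> and \<open>y\<close>, and there is at most one such
  \<open>T\<close>.\<close>

definition has_pvm_integral ::
    "'w measure \<Rightarrow> ('w set \<Rightarrow> ('a::complex_inner \<Rightarrow>\<^sub>L 'a)) \<Rightarrow> ('w \<Rightarrow> complex) \<Rightarrow>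
     ('a \<Rightarrow>\<^sub>L 'a) \<Rightarrow> bool" where
  "has_pvm_integral M P f T \<longleftrightarrow> T \<in> bounded_ops \<and>
     (\<forall>x. integrable (pvm_measure M P x) f \<and>
          cinner (blinfun_apply T x) x = (\<integral>\<omega>. f \<omega> \<partial>pvm_measure M P x))"

definition pvm_integral ::
    "'w measure \<Rightarrow> ('w set \<Rightarrow> ('a::complex_inner \<Rightarrow>\<^sub>L 'a)) \<Rightarrow> ('w \<Rightarrow> complex) \<Rightarrow>
     ('a \<Rightarrow>\<^sub>L 'a)" where
  "pvm_integral M P f = (THE T. has_pvm_integral M P f T)"

lemma has_pvm_integral_unique:
  fixes T1 T2 :: "'a::complex_inner \<Rightarrow>\<^sub>L 'a"
  assumes "has_pvm_integral M P f T1" and "has_pvm_integral M P f T2"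
  shows "T1 = T2"
proof -
  define D where "D = T1 - T2"
  have add: "blinfun_apply D (x + y) = blinfun_apply D x + blinfun_apply D y" for x y
    by (simp add: blinfun.add_right)
  have D0: "cinner (blinfun_apply D x) x = 0" for x
  proof -
    have "cinner (blinfun_apply T1 x) x
        = cinner (blinfun_apply D x) x + cinner (blinfun_apply T2 x) x"
      unfolding D_def cinner_add_left[symmetric] blinfun.diff_left by simp
    with assms show ?thesis by (simp add: has_pvm_integral_def)
  qed
  have Dc: "blinfun_apply D (c *\<^sub>C x) = c *\<^sub>C blinfun_apply D x" for c x
  proof -
    have "c *\<^sub>C (a - b) = c *\<^sub>C a - c *\<^sub>C b" for a b :: 'a
      using bounded_linear.linear[OF bounded_linear_scaleC] by (rule linear_diff)
    with assms show ?thesis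
      by (simp add: has_pvm_integral_def bounded_ops_def D_def blinfun.diff_left)
  qed
  have addr: "cinner x (y + z) = cinner x y + cinner x z" for x y z :: 'a
    by (metis cinner_commute cinner_add_left complex_cnj_add)
  have scr: "cinner x (c *\<^sub>C y) = cnj c * cinner x y" for c and x y :: 'a
    by (metis cinner_commute cinner_scaleC_left complex_cnj_mult)
  have s: "cinner (blinfun_apply D x) y + cinner (blinfun_apply D y) x = 0" for x y
    using D0[of "x + y"] D0[of x] D0[of y]
    by (simp add: add cinner_add_left addr algebra_simps)
  have z: "cinner (blinfun_apply D x) y = 0" for x y
  proof -
    have "\<i> * cinner (blinfun_apply D x) y = \<i> * cinner (blinfun_apply D y) x"
      using s[of "\<i> *\<^sub>C x" y] by (simp add: Dc cinner_scaleC_left scr)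
    with s[of x y] show ?thesis by simp
  qed
  have "blinfun_apply D x = 0" for x
    using z[of x "blinfun_apply D x"]
    by (metis inner_eq_Re_cinner inner_eq_zero_iff zero_complex.sel(1))
  then have "D = 0" by (intro blinfun_eqI) simp
  then show ?thesis by (simp add: D_def)
qed


section \<open>Infinite words and the dual group\<close>

text \<open>The letter \<open>\<omega>\<^sub>k\<close>, \<open>k \<ge> 1\<close>, of an infinite word is stored at index \<open>k - 1\<close>.\<close>

definition word_topology :: "nat \<Rightarrow> (nat \<Rightarrow> nat) topology" where
  "word_topology N = product_topology (\<lambda>_. discrete_topology {..<N}) UNIV"

definition inf_words :: "nat \<Rightarrow> (nat \<Rightarrow> nat) set" where
  "inf_words N = topspace (word_topology N)"

definition word_borel :: "nat \<Rightarrow> (nat \<Rightarrow> nat) measure" where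
  "word_borel N = sigma (inf_words N) {A. openin (word_topology N) A}"

definition fin_words :: "nat \<Rightarrow> nat \<Rightarrow> nat list set" where
  "fin_words N n = {I. length I = n \<and> set I \<subseteq> {..<N}}"

definition cylinder :: "nat \<Rightarrow> nat list \<Rightarrow> (nat \<Rightarrow> nat) set" where
  "cylinder N I = {\<omega> \<in> inf_words N. \<forall>k < length I. \<omega> k = I ! k}"

definition shift :: "(nat \<Rightarrow> nat) \<Rightarrow> (nat \<Rightarrow> nat)" where
  "shift \<omega> = (\<lambda>k. \<omega> (Suc k))"

definition branch :: "nat \<Rightarrow> (nat \<Rightarrow> nat) \<Rightarrow> (nat \<Rightarrow> nat)" where
  "branch i \<omega> = case_nat i \<omega>"

definition vanishes_from :: "(nat \<Rightarrow> nat) \<Rightarrow> nat \<Rightarrow> bool" where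
  "vanishes_from \<xi> n \<longleftrightarrow> (\<forall>k\<ge>n. \<xi> k = 0)"

definition dual_group :: "nat \<Rightarrow> (nat \<Rightarrow> nat) monoid" where
  "dual_group N =
     \<lparr>carrier = {\<xi> \<in> inf_words N. \<exists>p. vanishes_from \<xi> p},
      mult = (\<lambda>\<xi> \<eta> k. (\<xi> k + \<eta> k) mod N), one = (\<lambda>_. 0)\<rparr>"

lemma inf_words_iff: "\<omega> \<in> inf_words N \<longleftrightarrow> (\<forall>k. \<omega> k < N)"
  by (auto simp: inf_words_def word_topology_def)

lemma comm_group_dual_group:
  assumes "N > 0"
  shows "comm_group (dual_group N)"
proof (rule comm_groupI, goal_cases)
  case (1 x y)
  then obtain p q where "vanishes_from x p" "vanishes_from y q"
    by (auto simp: dual_group_def)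
  then have "vanishes_from (\<lambda>k. (x k + y k) mod N) (max p q)"
    by (simp add: vanishes_from_def)
  with assms show ?case by (auto simp: dual_group_def inf_words_iff)
next
  case (6 x)
  define y where "y = (\<lambda>k. (N - x k) mod N)"
  from 6 obtain p where "vanishes_from x p"
    by (auto simp: dual_group_def)
  then have "vanishes_from y p"
    by (simp add: vanishes_from_def y_def)
  then have "y \<in> carrier (dual_group N)"
    using assms by (auto simp: dual_group_def inf_words_iff y_def)
  moreover have "y \<otimes>\<^bsub>dual_group N\<^esub> x = \<one>\<^bsub>dual_group N\<^esub>"
    using 6 by (auto simp: dual_group_def inf_words_iff y_def mod_simps less_imp_le)
  ultimately show ?case by blast
qed (use assms in \<open>auto simp: dual_group_def inf_words_iff vanishes_from_def mod_simps add_ac\<close>)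

definition pairing :: "nat \<Rightarrow> (nat \<Rightarrow> nat) \<Rightarrow> (nat \<Rightarrow> nat) \<Rightarrow> complex" where
  "pairing N \<omega> \<xi> =
     (\<Prod>k. exp (2 * complex_of_real pi * \<i> * of_nat (\<omega> k) * of_nat (\<xi> k) / of_nat N))"

definition pad :: "nat list \<Rightarrow> (nat \<Rightarrow> nat)" where
  "pad I = (\<lambda>k. if k < length I then I ! k else 0)"

definition dual_shift :: "(nat \<Rightarrow> nat) \<Rightarrow> (nat \<Rightarrow> nat)" where
  "dual_shift \<xi> = case_nat 0 \<xi>"


section \<open>Representations of the Cuntz algebra\<close>

definition cuntz_rep :: "nat \<Rightarrow> (nat \<Rightarrow> ('a::complex_inner \<Rightarrow>\<^sub>L 'a)) \<Rightarrow> bool" where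
  "cuntz_rep N S \<longleftrightarrow>
     (\<forall>i<N. S i \<in> bounded_ops) \<and>
     (\<forall>i<N. \<forall>j<N. adj (S i) o\<^sub>L S j = (if i = j then id_blinfun else 0)) \<and>
     (\<Sum>i<N. S i o\<^sub>L adj (S i)) = id_blinfun"

primrec word_op :: "(nat \<Rightarrow> ('a::complex_inner \<Rightarrow>\<^sub>L 'a)) \<Rightarrow> nat list \<Rightarrow> ('a \<Rightarrow>\<^sub>L 'a)" where
  "word_op S [] = id_blinfun"
| "word_op S (i # I) = S i o\<^sub>L word_op S I"

text \<open>The \<open>n\<close> in \<open>\<xi> = \<xi>\<^sub>1\<dots>\<xi>\<^sub>n00\<dots>\<close> is not determined by \<open>\<xi>\<close>; \<open>dual_rep\<close> uses the
  least one. That every other choice gives the same operator has to be proved.\<close>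

definition dual_rep_sum ::
    "nat \<Rightarrow> (nat \<Rightarrow> ('a::complex_inner \<Rightarrow>\<^sub>L 'a)) \<Rightarrow> nat \<Rightarrow> (nat \<Rightarrow> nat) \<Rightarrow> ('a \<Rightarrow>\<^sub>L 'a)" where
  "dual_rep_sum N S n \<xi> =
     (\<Sum>I\<in>fin_words N n. scale_op (pairing N (pad I) \<xi>) (word_op S I o\<^sub>L adj (word_op S I)))"

definition dual_rep ::
    "nat \<Rightarrow> (nat \<Rightarrow> ('a::complex_inner \<Rightarrow>\<^sub>L 'a)) \<Rightarrow> (nat \<Rightarrow> nat) \<Rightarrow> ('a \<Rightarrow>\<^sub>L 'a)" where
  "dual_rep N S \<xi> = dual_rep_sum N S (LEAST n. vanishes_from \<xi> n) \<xi>"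

definition cuntz_endo ::
    "nat \<Rightarrow> (nat \<Rightarrow> ('a::complex_inner \<Rightarrow>\<^sub>L 'a)) \<Rightarrow> ('a \<Rightarrow>\<^sub>L 'a) \<Rightarrow> ('a \<Rightarrow>\<^sub>L 'a)" where
  "cuntz_endo N S T = (\<Sum>i<N. S i o\<^sub>L T o\<^sub>L adj (S i))"

definition extends_cylinders ::
    "nat \<Rightarrow> (nat \<Rightarrow> ('a::complex_inner \<Rightarrow>\<^sub>L 'a)) \<Rightarrow>
     ((nat \<Rightarrow> nat) set \<Rightarrow> ('a \<Rightarrow>\<^sub>L 'a)) \<Rightarrow> bool" where
  "extends_cylinders N S P \<longleftrightarrow>
     (\<forall>n. \<forall>I\<in>fin_words N n. P (cylinder N I) = word_op S I o\<^sub>L adj (word_op S I))"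

end

theory Submission
  imports Defs
begin

text \<open>
  Fix a vector \<open>x\<close>. The numbers \<open>(norm (S\<^sub>I\<^sup>* x))\<^sup>2\<close>, indexed by finite words \<open>I\<close>, are consistent:
  the relation \<open>\<Sum>\<^sub>j S\<^sub>jS\<^sub>j\<^sup>* = 1\<close> says that the weight of a word is the sum of the weights of its
  extensions by one letter. As \<open>K\<close> is compact, such a system is the restriction to cylinders of
  a measure \<open>\<mu>\<^sub>x\<close> (\<open>measure_from_weights\<close>). The sets \<open>A\<close> for which there is a projection
  \<open>E\<close> with \<open>\<mu>\<^sub>x(A) = (norm (E x))\<^sup>2\<close> for every \<open>x\<close> form a Dynkin system that contains the cylinders,
  hence are all Borel sets, and \<open>E\<close> is \<open>P(A)\<close> (\<open>pvm_from_measures\<close>). Disjoint sets receive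
  orthogonal projections, because measures add up to at most \<open>(norm x)\<^sup>2\<close>; this one observation gives
  strong convergence in countable additivity as well as \<open>P(A \<inter> B) = P(A) P(B)\<close>.

  All remaining claims concern an arbitrary projection-valued measure \<open>P\<close> that extends the cylinder
  projections. The covariance relation \<open>S\<^sub>i P(A) S\<^sub>i\<^sup>* = P(\<sigma>\<^sub>i(A))\<close> is checked on cylinders and
  propagates to Borel sets by the \<open>\<pi>\<close>-\<open>\<lambda>\<close> theorem (\<open>covariance\<close>). Summation over \<open>i\<close> gives the
  formula for \<open>\<Sum>\<^sub>j S\<^sub>j P(\<sigma>\<^sub>j\<^sup>-\<^sup>1(A)) S\<^sub>j\<^sup>*\<close> and \<open>\<alpha>(P(A)) = P(\<sigma>\<^sup>-\<^sup>1(A))\<close>. In terms of scalar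
  measures, covariance says that \<open>\<sigma>\<^sub>i\<close> pushes the measure of \<open>S\<^sub>i\<^sup>* x\<close> forward to the part of the
  measure of \<open>x\<close> on \<open>C(i)\<close>, whence the formula for \<open>\<alpha>\<close> of an integral (\<open>has_pvm_integral_shift\<close>).

  The operator \<open>U(\<xi>)\<close> is the integral of the simple function \<open>\<langle>\<sqdot>, \<xi>\<rangle>\<close>
  (\<open>has_pvm_integral_dual_rep_sum\<close>). Since integrals are unique, \<open>U(\<xi>)\<close> is independent of the length
  of the words used to write it, and \<open>\<alpha>(U(\<xi>))\<close> is the integral of
  \<open>\<langle>\<sigma>(\<sqdot>), \<xi>\<rangle>\<close>, the character of the shifted \<open>\<xi>\<close>. The homomorphism property and unitarity
  hold because operators diagonal with respect to the projections of words of one length multiply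
  coefficientwise.

  Two pieces of operator theory underlie this: adjoints exist by the Riesz representation theorem,
  and every bounded measurable function has an integral, as a norm limit of integrals of
  simple functions.
\<close>


section \<open>Inner products, adjoints and bounded operators\<close>

lemma cinner_add_right: "cinner x (y + z) = cinner x y + cinner x z"
  by (metis cinner_commute cinner_add_left complex_cnj_add)

lemma cinner_scaleC_right: "cinner x (c *\<^sub>C y) = cnj c * cinner x y"
  by (metis cinner_commute cinner_scaleC_left complex_cnj_mult)

lemma cinner_zero_left [simp]: "cinner 0 x = 0"
  by (metis add_cancel_right_right cinner_add_left)

lemma cinner_zero_right [simp]: "cinner x 0 = 0"
  by (metis add_cancel_right_right cinner_add_right)

lemma cinner_sum_left: "cinner (\<Sum>i\<in>F. f i) y = (\<Sum>i\<in>F. cinner (f i) y)"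
  by (induction F rule: infinite_finite_induct) (auto simp: cinner_add_left)

lemma cinner_sum_right: "cinner y (\<Sum>i\<in>F. f i) = (\<Sum>i\<in>F. cinner y (f i))"
  by (induction F rule: infinite_finite_induct) (auto simp: cinner_add_right)

lemma cinner_diff_left: "cinner (x - y) z = cinner x z - cinner y z"
  by (metis cinner_add_left diff_add_cancel eq_diff_eq)

lemma cinner_diff_right: "cinner z (x - y) = cinner z x - cinner z y"
  by (metis cinner_add_right diff_add_cancel eq_diff_eq)

lemma cinner_self: "cinner x x = complex_of_real ((norm x)\<^sup>2)"
proof (rule complex_eqI)
  show "Re (cinner x x) = Re (complex_of_real ((norm x)\<^sup>2))"
    by (simp add: inner_eq_Re_cinner[symmetric] power2_norm_eq_inner)
  show "Im (cinner x x) = Im (complex_of_real ((norm x)\<^sup>2))"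
    using cinner_commute[of x x] by (simp add: complex_eq_iff)
qed

text \<open>Rotating \<open>x\<close> by a unit scalar makes the inner product real and nonnegative, so that the real
  Cauchy-Schwarz inequality applies.\<close>

lemma norm_cinner_le: "cmod (cinner x y) \<le> norm x * norm y"
proof (cases "cinner x y = 0")
  case False
  define c where "c = cnj (sgn (cinner x y))"
  have "cmod c = 1" using False by (simp add: c_def norm_sgn)
  have "complex_of_real (cmod (cinner x y)) = c * cinner x y"
    using False by (simp add: c_def sgn_eq complex_norm_square[symmetric] power2_eq_square
        mult.commute[of "cnj _"])
  then have "cmod (cinner x y) = Re (cinner (c *\<^sub>C x) y)"
    by (metis Re_complex_of_real cinner_scaleC_left)
  also have "\<dots> \<le> norm (c *\<^sub>C x) * norm y"
    unfolding inner_eq_Re_cinner[symmetric] by (rule norm_cauchy_schwarz)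
  finally show ?thesis by (simp add: norm_scaleC \<open>cmod c = 1\<close>)
qed simp

lemma bounded_linear_cinner_left: "bounded_linear (\<lambda>x. cinner x y)"
  by (rule bounded_linear_intro[where K = "norm y"])
    (auto simp: cinner_add_left norm_cinner_le scaleC_of_real[symmetric] cinner_scaleC_left
      scaleR_conv_of_real)

lemma bounded_linear_cinner_right: "bounded_linear (\<lambda>y. cinner x y)"
  by (rule bounded_linear_intro[where K = "norm x"])
    (auto simp: cinner_add_right norm_cinner_le scaleC_of_real[symmetric] cinner_scaleC_right
      scaleR_conv_of_real mult.commute[of "norm _" "norm x"])

lemma cinner_eqI: "(\<And>x. cinner x y = cinner x z) \<Longrightarrow> y = z"
  by (metis cinner_diff_right inner_eq_Re_cinner inner_eq_zero_iff right_minus_eq zero_complex.sel(1))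

lemma scaleC_one [simp]: "1 *\<^sub>C x = x"
  using scaleC_of_real[of 1 x] by simp

text \<open>The representing vector is the minimizer of \<open>J x = (norm x)\<^sup>2 / 2 - f x\<close>. A minimizing sequence
  is Cauchy by the parallelogram law, and the first-order condition at the minimum says that \<open>f\<close>
  is the inner product with it.\<close>

lemma riesz_representation:
  fixes f :: "'a::{real_inner, complete_space} \<Rightarrow> real"
  assumes "bounded_linear f"
  shows "\<exists>y. \<forall>x. f x = inner x y"
proof -
  interpret f: bounded_linear f by fact
  define J where "J x = (norm x)\<^sup>2 / 2 - f x" for x
  obtain K where K: "\<And>x. norm (f x) \<le> norm x * K"
    using f.bounded by blast
  have "- (K\<^sup>2 / 2) \<le> J x" for x
  proof -
    have "f x \<le> norm x * K" using K[of x] by simp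
    moreover have "0 \<le> (norm x - K)\<^sup>2" by simp
    ultimately show ?thesis unfolding J_def by (simp add: power2_eq_square algebra_simps)
  qed
  then have bdd: "bdd_below (range J)" by (rule bdd_belowI2)
  define m where "m = (INF x. J x)"
  have m_le: "m \<le> J x" for x
    unfolding m_def by (rule cINF_lower[OF bdd]) simp
  have "\<exists>x. J x < m + inverse (real (Suc n))" for n
  proof -
    have "(INF x. J x) < m + inverse (real (Suc n))" by (simp add: m_def)
    then show ?thesis by (subst (asm) cINF_less_iff[OF _ bdd]) auto
  qed
  then obtain X where X: "\<And>n. J (X n) < m + inverse (real (Suc n))" by metis
  have par: "(norm (x - y))\<^sup>2 = 4 * (J x + J y - 2 * J ((1/2) *\<^sub>R (x + y)))" for x y
    by (simp add: J_def f.add f.scaleR power2_norm_eq_inner inner_add_left inner_add_right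
        inner_diff_left inner_diff_right inner_commute field_simps)
  have "Cauchy X"
  proof (rule metric_CauchyI)
    fix e :: real assume "e > 0"
    obtain M :: nat where M: "inverse (real (Suc M)) < e\<^sup>2 / 8"
      using reals_Archimedean[of "e\<^sup>2 / 8"] \<open>e > 0\<close> by auto
    have "dist (X i) (X j) < e" if "i \<ge> M" "j \<ge> M" for i j
    proof -
      have inv: "inverse (real (Suc k)) < e\<^sup>2 / 8" if "k \<ge> M" for k
        using that M by (smt (verit) inverse_le_iff_le of_nat_0_less_iff of_nat_le_iff zero_less_Suc Suc_le_mono)
      have "J (X i) < m + e\<^sup>2 / 8" "J (X j) < m + e\<^sup>2 / 8"
        using X[of i] X[of j] inv[OF that(1)] inv[OF that(2)] by (meson add_strict_left_mono less_trans)+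
      then have "J (X i) + J (X j) - 2 * J ((1/2) *\<^sub>R (X i + X j)) < e\<^sup>2 / 4"
        using m_le[of "(1/2) *\<^sub>R (X i + X j)"] by argo
      then have "(norm (X i - X j))\<^sup>2 < e\<^sup>2"
        unfolding par by argo
      then show ?thesis using \<open>e > 0\<close>
        by (simp add: dist_norm power_less_imp_less_base)
    qed
    then show "\<exists>M. \<forall>i\<ge>M. \<forall>j\<ge>M. dist (X i) (X j) < e" by blast
  qed
  then obtain y where y: "X \<longlonglongrightarrow> y"
    using Cauchy_convergent convergent_def by blast
  have "(\<lambda>n. J (X n)) \<longlonglongrightarrow> J y"
    unfolding J_def by (auto intro!: tendsto_intros f.tendsto y)
  moreover have "(\<lambda>n. m + inverse (real (Suc n))) \<longlonglongrightarrow> m + 0"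
    by (intro tendsto_intros LIMSEQ_inverse_real_of_nat)
  ultimately have "J y \<le> m + 0"
    by (rule LIMSEQ_le) (use X in \<open>auto intro: less_imp_le\<close>)
  then have min: "J y \<le> J x" for x using m_le[of x] by simp
  have "f h = inner h y" for h
  proof -
    define d where "d = inner h y - f h"
    define q where "q = (norm h)\<^sup>2 + 1"
    have q: "q > 0" "(norm h)\<^sup>2 \<le> q" by (auto simp: q_def add_nonneg_pos)
    have J_line: "J (y + t *\<^sub>R h) = J y + t * d + t\<^sup>2 * (norm h)\<^sup>2 / 2" for t
      by (simp add: J_def d_def f.add f.scaleR power2_norm_eq_inner inner_add_left inner_add_right
         inner_commute[of y h] power2_eq_square[of t] field_simps)
    \<comment> \<open>The exact minimum over \<open>t\<close> would be at \<open>- d / (norm h)\<^sup>2\<close>; adding \<open>1\<close> to the denominator also covers \<open>h = 0\<close>.\<close>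
    have "J (y + (- d / q) *\<^sub>R h) = J y + (- d / q) * d + (d / q)\<^sup>2 * (norm h)\<^sup>2 / 2"
      unfolding J_line by simp
    with min have "0 \<le> (- d / q) * d + (d / q)\<^sup>2 * (norm h)\<^sup>2 / 2"
      by (smt (verit))
    also have "\<dots> \<le> (- d / q) * d + (d / q)\<^sup>2 * q / 2"
      using q by (intro add_left_mono divide_right_mono mult_left_mono) auto
    also have "\<dots> = - (d\<^sup>2 / (2 * q))"
      using q by (simp add: power2_eq_square field_simps)
    finally have "d\<^sup>2 / (2 * q) \<le> 0" by simp
    then have "d = 0" using q(1) by (simp add: divide_le_0_iff)
    then show ?thesis by (simp add: d_def)
  qed
  then show ?thesis by blast
qed

text \<open>This makes the space of bounded operators complete, in which integrals will be constructed as
  limits.\<close>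

instance chilbert_space \<subseteq> banach ..

text \<open>The Riesz theorem represents only the real part of \<open>x \<mapsto> \<langle>Tx, y\<rangle>\<close>. Complex linearity of \<open>T\<close>
  recovers the imaginary part, by passing from \<open>x\<close> to \<open>- \<i> x\<close>.\<close>

lemma is_adj_exists:
  fixes T :: "'a::chilbert_space \<Rightarrow>\<^sub>L 'a"
  assumes T: "T \<in> bounded_ops"
  shows "\<exists>T'. is_adj T T'"
proof -
  have "\<exists>z. \<forall>x. cinner (blinfun_apply T x) y = cinner x z" for y
  proof -
    have "bounded_linear (\<lambda>x. Re (cinner (blinfun_apply T x) y))"
      by (intro bounded_linear_compose[OF bounded_linear_Re]
          bounded_linear_compose[OF bounded_linear_cinner_left] blinfun.bounded_linear_right)
    then obtain z where "\<And>x. Re (cinner (blinfun_apply T x) y) = inner x z"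
      using riesz_representation by blast
    then have z: "\<And>x. Re (cinner (blinfun_apply T x) y) = Re (cinner x z)"
      by (simp add: inner_eq_Re_cinner)
    have "cinner (blinfun_apply T x) y = cinner x z" for x
    proof (rule complex_eqI[OF z])
      have "blinfun_apply T ((- \<i>) *\<^sub>C x) = (- \<i>) *\<^sub>C blinfun_apply T x"
        using T by (simp add: bounded_ops_def)
      with z[of "(- \<i>) *\<^sub>C x"] show "Im (cinner (blinfun_apply T x) y) = Im (cinner x z)"
        by (simp add: cinner_scaleC_left)
    qed
    then show ?thesis by blast
  qed
  then obtain Z where Z: "\<And>x y. cinner (blinfun_apply T x) y = cinner x (Z y)" by metis
  have "bounded_linear Z"
  proof (rule bounded_linear_intro[where K = "norm T"])
    show "Z (y + z) = Z y + Z z" for y z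
      by (rule cinner_eqI) (simp add: Z[symmetric] cinner_add_right)
    show "Z (r *\<^sub>R y) = r *\<^sub>R Z y" for r y
      by (rule cinner_eqI)
        (simp add: Z[symmetric] scaleC_of_real[symmetric] cinner_scaleC_right)
    show "norm (Z y) \<le> norm y * norm T" for y
    proof -
      have "norm (Z y) * norm (Z y) = cmod (cinner (Z y) (Z y))"
        by (simp add: cinner_self power2_eq_square norm_mult)
      also have "\<dots> = cmod (cinner (blinfun_apply T (Z y)) y)"
        by (simp add: Z)
      also have "\<dots> \<le> norm (blinfun_apply T (Z y)) * norm y" by (rule norm_cinner_le)
      also have "\<dots> \<le> norm T * norm (Z y) * norm y"
        by (intro mult_right_mono norm_blinfun) simp
      finally have "norm (Z y) * norm (Z y) \<le> norm (Z y) * (norm y * norm T)"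
        by (simp add: mult_ac)
      then show ?thesis
        by (cases "norm (Z y) = 0") (simp_all add: mult_le_cancel_left)
    qed
  qed
  then have "is_adj T (Blinfun Z)"
    by (simp add: is_adj_def bounded_linear_Blinfun_apply Z)
  then show ?thesis ..
qed

lemma adj_eqI: "is_adj T T' \<Longrightarrow> adj T = T'"
  unfolding adj_def by (rule the_equality) (auto intro: is_adj_unique)

lemma is_adj_adj:
  fixes T :: "'a::chilbert_space \<Rightarrow>\<^sub>L 'a"
  shows "T \<in> bounded_ops \<Longrightarrow> is_adj T (adj T)"
  using is_adj_exists adj_eqI by metis

lemma cinner_adj:
  fixes T :: "'a::chilbert_space \<Rightarrow>\<^sub>L 'a"
  assumes "T \<in> bounded_ops"
  shows cinner_adj_right: "cinner x (blinfun_apply (adj T) y) = cinner (blinfun_apply T x) y"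
    and cinner_adj_left: "cinner (blinfun_apply (adj T) x) y = cinner x (blinfun_apply T y)"
  using is_adj_adj[OF assms] unfolding is_adj_def by (metis cinner_commute)+

lemma is_adj_bounded_ops: "is_adj T T' \<Longrightarrow> T' \<in> bounded_ops"
  unfolding bounded_ops_def is_adj_def mem_Collect_eq
  by (intro allI, rule cinner_eqI) (metis cinner_scaleC_right)

lemma is_adj_id: "is_adj id_blinfun id_blinfun"
  by (simp add: is_adj_def)

lemma is_adj_zero: "is_adj 0 0"
  by (simp add: is_adj_def)

lemma is_adj_sym: "is_adj T T' \<Longrightarrow> is_adj T' T"
  unfolding is_adj_def by (metis cinner_commute)

lemma is_adj_compose: "is_adj T T' \<Longrightarrow> is_adj R R' \<Longrightarrow> is_adj (T o\<^sub>L R) (R' o\<^sub>L T')"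
  unfolding is_adj_def by simp

lemma is_adj_scale: "is_adj T T' \<Longrightarrow> is_adj (scale_op c T) (scale_op (cnj c) T')"
  unfolding is_adj_def by (simp add: scale_op.rep_eq cinner_scaleC_left cinner_scaleC_right)

lemma is_adj_sum: "(\<And>i. i \<in> F \<Longrightarrow> is_adj (T i) (T' i)) \<Longrightarrow> is_adj (\<Sum>i\<in>F. T i) (\<Sum>i\<in>F. T' i)"
  unfolding is_adj_def by (simp add: blinfun.sum_left cinner_sum_left cinner_sum_right)

lemma bounded_opsD: "T \<in> bounded_ops \<Longrightarrow> blinfun_apply T (c *\<^sub>C x) = c *\<^sub>C blinfun_apply T x"
  by (simp add: bounded_ops_def)

lemma scaleC_sum_right: "c *\<^sub>C (\<Sum>i\<in>F. f i) = (\<Sum>i\<in>F. c *\<^sub>C f i)"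
  using bounded_linear.linear[OF bounded_linear_scaleC] by (rule linear_sum)

lemma scaleC_diff_right: "c *\<^sub>C (x - y) = c *\<^sub>C x - c *\<^sub>C y"
  using bounded_linear.linear[OF bounded_linear_scaleC] by (rule linear_diff)

lemma scaleC_zero_right [simp]: "c *\<^sub>C 0 = 0"
  using bounded_linear.linear[OF bounded_linear_scaleC] by (rule linear_0)

lemma bounded_ops_intros:
  shows "id_blinfun \<in> bounded_ops" "0 \<in> bounded_ops"
    and "T \<in> bounded_ops \<Longrightarrow> R \<in> bounded_ops \<Longrightarrow> T o\<^sub>L R \<in> bounded_ops"
    and "T \<in> bounded_ops \<Longrightarrow> R \<in> bounded_ops \<Longrightarrow> T + R \<in> bounded_ops"
    and "T \<in> bounded_ops \<Longrightarrow> R \<in> bounded_ops \<Longrightarrow> T - R \<in> bounded_ops"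
    and "T \<in> bounded_ops \<Longrightarrow> scale_op c T \<in> bounded_ops"
    and "(\<And>i. i \<in> F \<Longrightarrow> T' i \<in> bounded_ops) \<Longrightarrow> (\<Sum>i\<in>F. T' i) \<in> bounded_ops"
  by (auto simp: bounded_ops_def blinfun.add_left blinfun.diff_left blinfun.sum_left
      scaleC_add_right scaleC_diff_right scale_op.rep_eq scaleC_scaleC mult.commute scaleC_sum_right)

lemma compose_id_blinfun: "T o\<^sub>L id_blinfun = T"
  by (rule blinfun_eqI) simp

lemma adj_bounded_ops:
  fixes T :: "'a::chilbert_space \<Rightarrow>\<^sub>L 'a"
  shows "T \<in> bounded_ops \<Longrightarrow> adj T \<in> bounded_ops"
  using is_adj_adj is_adj_bounded_ops by blast

text \<open>This is uniqueness of the integral: the difference \<open>T - R\<close> and the operator \<open>0\<close> both integrate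
  the zero function.\<close>

lemma quadratic_form_determines:
  fixes T R :: "'a::chilbert_space \<Rightarrow>\<^sub>L 'a"
  assumes "T \<in> bounded_ops" "R \<in> bounded_ops"
    and eq: "\<And>x. cinner (blinfun_apply T x) x = cinner (blinfun_apply R x) x"
  shows "T = R"
proof -
  have "has_pvm_integral M P (\<lambda>_. 0) (T - R)" "has_pvm_integral M P (\<lambda>_. 0) 0"
    for M :: "nat measure" and P
    using assms by (auto simp: has_pvm_integral_def bounded_ops_intros blinfun.diff_left cinner_diff_left)
  then have "T - R = 0" by (rule has_pvm_integral_unique)
  then show ?thesis by simp
qed

section \<open>Orthogonal projections\<close>

lemma projection_op_iff:
  fixes E :: "'a::chilbert_space \<Rightarrow>\<^sub>L 'a"
  shows "projection_op E \<longleftrightarrow> E o\<^sub>L E = E \<and> is_adj E E"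
  unfolding projection_op_def by (metis adj_eqI is_adj_adj is_adj_bounded_ops)

lemma cinner_projection:
  fixes E :: "'a::chilbert_space \<Rightarrow>\<^sub>L 'a"
  assumes "projection_op E"
  shows "cinner (blinfun_apply E x) x = complex_of_real ((norm (blinfun_apply E x))\<^sup>2)"
proof -
  have "cinner (blinfun_apply E x) x = cinner (blinfun_apply (E o\<^sub>L E) x) x"
    using assms by (simp add: projection_op_iff)
  also have "\<dots> = cinner (blinfun_apply E x) (blinfun_apply E x)"
    using assms unfolding projection_op_iff is_adj_def by (metis blinfun_apply_blinfun_compose)
  finally show ?thesis by (simp add: cinner_self)
qed

text \<open>Evaluating the inequality at a vector \<open>E x\<close> of the range of \<open>E\<close> leaves no room for \<open>F (E x)\<close>.
  In this way additivity of a measure forces orthogonality of the projections of disjoint sets.\<close>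

lemma orthogonal_projections:
  fixes E F :: "'a::chilbert_space \<Rightarrow>\<^sub>L 'a"
  assumes E: "projection_op E" and F: "projection_op F"
    and le: "\<And>x. (norm (blinfun_apply E x))\<^sup>2 + (norm (blinfun_apply F x))\<^sup>2 \<le> (norm x)\<^sup>2"
  shows "F o\<^sub>L E = 0"
proof (rule blinfun_eqI)
  fix x
  have "blinfun_apply E (blinfun_apply E x) = blinfun_apply E x"
    using E by (metis projection_op_iff blinfun_apply_blinfun_compose)
  with le[of "blinfun_apply E x"] show "blinfun_apply (F o\<^sub>L E) x = blinfun_apply 0 x"
    by simp
qed

lemma norm_projection_le:
  fixes E :: "'a::chilbert_space \<Rightarrow>\<^sub>L 'a"
  assumes "projection_op E"
  shows "norm (blinfun_apply E x) \<le> norm x"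
proof -
  have "(norm (blinfun_apply E x))\<^sup>2 \<le> norm (blinfun_apply E x) * norm x"
    using norm_cinner_le[of "blinfun_apply E x" x] cinner_projection[OF assms, of x]
    by (simp add: norm_power)
  then show ?thesis
    by (cases "norm (blinfun_apply E x) = 0") (simp_all add: power2_eq_square mult_le_cancel_left)
qed

lemma projection_op_Diff:
  fixes E :: "'a::chilbert_space \<Rightarrow>\<^sub>L 'a"
  assumes "projection_op E"
  shows "projection_op (id_blinfun - E)"
    and "(norm (blinfun_apply (id_blinfun - E) x))\<^sup>2 = (norm x)\<^sup>2 - (norm (blinfun_apply E x))\<^sup>2"
proof -
  have EE: "blinfun_apply E (blinfun_apply E y) = blinfun_apply E y" for y
    using assms by (metis projection_op_iff blinfun_apply_blinfun_compose)
  show p: "projection_op (id_blinfun - E)"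
    unfolding projection_op_iff
  proof
    show "(id_blinfun - E) o\<^sub>L (id_blinfun - E) = id_blinfun - E"
      by (rule blinfun_eqI) (simp add: blinfun.diff_left blinfun.diff_right EE)
    show "is_adj (id_blinfun - E) (id_blinfun - E)"
      using assms by (simp add: projection_op_iff is_adj_def blinfun.diff_left cinner_diff_left cinner_diff_right)
  qed
  have "complex_of_real ((norm (blinfun_apply (id_blinfun - E) x))\<^sup>2)
      = complex_of_real ((norm x)\<^sup>2 - (norm (blinfun_apply E x))\<^sup>2)"
    unfolding cinner_projection[OF p, symmetric] of_real_diff cinner_projection[OF assms, symmetric]
    by (simp add: blinfun.diff_left cinner_diff_left cinner_self)
  then show "(norm (blinfun_apply (id_blinfun - E) x))\<^sup>2 = (norm x)\<^sup>2 - (norm (blinfun_apply E x))\<^sup>2"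
    unfolding of_real_eq_iff .
qed

lemma projection_op_id: "projection_op (id_blinfun :: 'a::chilbert_space \<Rightarrow>\<^sub>L 'a)"
  by (auto simp: projection_op_iff is_adj_id intro: blinfun_eqI)

lemma projection_op_eqI:
  fixes E F :: "'a::chilbert_space \<Rightarrow>\<^sub>L 'a"
  assumes "projection_op E" "projection_op F"
    and "\<And>x. norm (blinfun_apply E x) = norm (blinfun_apply F x)"
  shows "E = F"
  using assms by (intro quadratic_form_determines) (auto simp: cinner_projection projection_op_def)

text \<open>The Pythagorean identity follows from the fact that the sum is itself a projection \<open>Q\<close>, since
  \<open>(norm (Q x))\<^sup>2 = \<langle>Qx, x\<rangle>\<close> is additive in \<open>Q\<close>.\<close>

lemma projection_op_sum:
  fixes E :: "'i \<Rightarrow> ('a::chilbert_space \<Rightarrow>\<^sub>L 'a)"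
  assumes E: "\<And>i. i \<in> F \<Longrightarrow> projection_op (E i)"
    and orth: "\<And>i j. i \<in> F \<Longrightarrow> j \<in> F \<Longrightarrow> i \<noteq> j \<Longrightarrow> E i o\<^sub>L E j = 0" and "finite F"
  shows "projection_op (\<Sum>i\<in>F. E i)"
    and "(norm (\<Sum>i\<in>F. blinfun_apply (E i) x))\<^sup>2 = (\<Sum>i\<in>F. (norm (blinfun_apply (E i) x))\<^sup>2)"
proof -
  have app: "blinfun_apply (E i) (blinfun_apply (E j) y) = (if i = j then blinfun_apply (E i) y else 0)"
    if "i \<in> F" "j \<in> F" for i j y
    using orth[OF that] E[OF that(1)]
    by (metis blinfun_apply_blinfun_compose projection_op_iff zero_blinfun.rep_eq)
  show p: "projection_op (\<Sum>i\<in>F. E i)"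
    unfolding projection_op_iff
  proof
    show "(\<Sum>i\<in>F. E i) o\<^sub>L (\<Sum>i\<in>F. E i) = (\<Sum>i\<in>F. E i)"
      using \<open>finite F\<close> by (intro blinfun_eqI) (simp add: blinfun.sum_left blinfun.sum_right app)
    show "is_adj (\<Sum>i\<in>F. E i) (\<Sum>i\<in>F. E i)"
      using E by (intro is_adj_sum) (simp add: projection_op_iff)
  qed
  have "complex_of_real ((norm (\<Sum>i\<in>F. blinfun_apply (E i) x))\<^sup>2)
      = complex_of_real (\<Sum>i\<in>F. (norm (blinfun_apply (E i) x))\<^sup>2)"
    using cinner_projection[OF p, of x] E
    by (simp add: blinfun.sum_left cinner_sum_left cinner_projection)
  then show "(norm (\<Sum>i\<in>F. blinfun_apply (E i) x))\<^sup>2 = (\<Sum>i\<in>F. (norm (blinfun_apply (E i) x))\<^sup>2)"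
    unfolding of_real_eq_iff .
qed

text \<open>By Pythagoras the partial sums are contractions, so the squared norms of the terms are
  summable, and the same identity turns this into the Cauchy property of the vector series.\<close>

lemma orthogonal_projections_sums:
  fixes E :: "nat \<Rightarrow> ('a::chilbert_space \<Rightarrow>\<^sub>L 'a)"
  assumes E: "\<And>n. projection_op (E n)" and orth: "\<And>n m. n \<noteq> m \<Longrightarrow> E n o\<^sub>L E m = 0"
  obtains F where "projection_op F" "\<And>x. (\<lambda>n. blinfun_apply (E n) x) sums blinfun_apply F x"
    "\<And>x. (\<lambda>n. (norm (blinfun_apply (E n) x))\<^sup>2) sums (norm (blinfun_apply F x))\<^sup>2"
proof -
  have pyth: "(norm (\<Sum>n\<in>K. blinfun_apply (E n) x))\<^sup>2 = (\<Sum>n\<in>K. (norm (blinfun_apply (E n) x))\<^sup>2)"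
    if "finite K" for K x
    by (rule projection_op_sum(2)[OF E orth that])
  have contr: "norm (\<Sum>n\<in>K. blinfun_apply (E n) x) \<le> norm x" if "finite K" for K x
    using norm_projection_le[OF projection_op_sum(1)[of K E, OF E orth that], of x]
    by (simp add: blinfun.sum_left)
  have "summable (\<lambda>n. blinfun_apply (E n) x)" for x
    unfolding summable_Cauchy
  proof (intro allI impI)
    fix e :: real assume "e > 0"
    have "summable (\<lambda>n. (norm (blinfun_apply (E n) x))\<^sup>2)"
    proof (rule summableI_nonneg_bounded)
      show "(\<Sum>n<k. (norm (blinfun_apply (E n) x))\<^sup>2) \<le> (norm x)\<^sup>2" for k
        using contr[of "{..<k}" x] pyth[of "{..<k}" x] by (metis finite_lessThan norm_ge_zero power_mono)
    qed simp
    then obtain K where K: "\<And>m n. m \<ge> K \<Longrightarrow> norm (\<Sum>n\<in>{m..<n}. (norm (blinfun_apply (E n) x))\<^sup>2) < e\<^sup>2"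
      unfolding summable_Cauchy using \<open>e > 0\<close> by (meson zero_less_power)
    have "norm (\<Sum>n\<in>{m..<n}. blinfun_apply (E n) x) < e" if "m \<ge> K" for m n
    proof (rule power_less_imp_less_base)
      show "(norm (\<Sum>n\<in>{m..<n}. blinfun_apply (E n) x))\<^sup>2 < e\<^sup>2"
        unfolding pyth[OF finite_atLeastLessThan]
        using order_le_less_trans[OF abs_ge_self K[OF that, of n, unfolded real_norm_def]] .
    qed (use \<open>e > 0\<close> in simp)
    then show "\<exists>K. \<forall>m\<ge>K. \<forall>n. norm (\<Sum>n\<in>{m..<n}. blinfun_apply (E n) x) < e" by blast
  qed
  then have sms: "(\<lambda>n. blinfun_apply (E n) x) sums (\<Sum>n. blinfun_apply (E n) x)" for x
    by (rule summable_sums)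
  define f where "f x = (\<Sum>n. blinfun_apply (E n) x)" for x
  have "bounded_linear f"
  proof (rule bounded_linear_intro[where K = 1])
    show "f (x + y) = f x + f y" for x y
      unfolding f_def using sums_add[OF sms sms, of x y] sms[of "x + y"]
      by (simp add: blinfun.add_right sums_unique2)
    show "f (r *\<^sub>R x) = r *\<^sub>R f x" for r x
      unfolding f_def using sums_scaleR_right[OF sms, of r x] sms[of "r *\<^sub>R x"]
      by (simp add: blinfun.scaleR_right sums_unique2)
    show "norm (f x) \<le> norm x * 1" for x
      using LIMSEQ_le_const2[OF tendsto_norm[OF sms[unfolded sums_def, of x]], of "norm x"]
        contr[OF finite_lessThan, where x = x] by (simp add: f_def)
  qed
  then have F: "blinfun_apply (Blinfun f) x = f x" for x by (simp add: bounded_linear_Blinfun_apply)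
  have sm: "(\<lambda>n. blinfun_apply (E n) x) sums f x" for x using sms by (simp add: f_def)
  have "E n o\<^sub>L E m = (if n = m then E n else 0)" for n m
    using E orth by (simp add: projection_op_iff)
  then have app: "blinfun_apply (E n) (blinfun_apply (E m) x) = (if n = m then blinfun_apply (E n) x else 0)" for n m x
    by (metis blinfun_apply_blinfun_compose zero_blinfun.rep_eq)
  have Ef: "blinfun_apply (E n) (f x) = blinfun_apply (E n) x" for n x
  proof -
    have "(\<lambda>m. blinfun_apply (E n) (blinfun_apply (E m) x)) sums blinfun_apply (E n) (f x)"
      by (intro bounded_linear.sums[OF blinfun.bounded_linear_right] sm)
    moreover have "(\<lambda>m. blinfun_apply (E n) (blinfun_apply (E m) x)) sums blinfun_apply (E n) x"
      unfolding app using sums_single[of n "\<lambda>_. blinfun_apply (E n) x"] by (simp add: eq_commute)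
    ultimately show ?thesis by (rule sums_unique2)
  qed
  have proj: "projection_op (Blinfun f)"
    unfolding projection_op_iff
  proof
    show "Blinfun f o\<^sub>L Blinfun f = Blinfun f"
    proof (rule blinfun_eqI)
      fix x
      have "f (f x) = f x" using sm[of "f x"] sm[of x] by (simp add: Ef sums_unique2)
      then show "blinfun_apply (Blinfun f o\<^sub>L Blinfun f) x = blinfun_apply (Blinfun f) x" by (simp add: F)
    qed
    show "is_adj (Blinfun f) (Blinfun f)"
      unfolding is_adj_def F
    proof (intro allI)
      fix x y
      have "(\<lambda>n. cinner (blinfun_apply (E n) x) y) sums cinner (f x) y"
        by (intro bounded_linear.sums[OF bounded_linear_cinner_left] sm)
      moreover have "(\<lambda>n. cinner x (blinfun_apply (E n) y)) sums cinner x (f y)"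
        by (intro bounded_linear.sums[OF bounded_linear_cinner_right] sm)
      moreover have "cinner (blinfun_apply (E n) x) y = cinner x (blinfun_apply (E n) y)" for n
        using E by (simp add: projection_op_iff is_adj_def)
      ultimately show "cinner (f x) y = cinner x (f y)" by (simp add: sums_unique2)
    qed
  qed
  show thesis
  proof
    show "(\<lambda>n. (norm (blinfun_apply (E n) x))\<^sup>2) sums (norm (blinfun_apply (Blinfun f) x))\<^sup>2" for x
      using tendsto_power[OF tendsto_norm[OF sm[unfolded sums_def, of x]], of 2]
      by (simp add: pyth F sums_def)
  qed (use proj sm F in auto)
qed

section \<open>Cylinder sets and the Borel structure of the word space\<close>

text \<open>The sets determined by a prefix of some length are the clopen sets. They form the algebra on
  which measures are first defined.\<close>

definition determined_by_prefix :: "nat \<Rightarrow> nat \<Rightarrow> (nat \<Rightarrow> nat) set \<Rightarrow> bool" where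
  "determined_by_prefix N n A \<longleftrightarrow> A \<subseteq> inf_words N \<and>
     (\<forall>\<omega>\<in>A. \<forall>\<omega>'\<in>inf_words N. (\<forall>k<n. \<omega>' k = \<omega> k) \<longrightarrow> \<omega>' \<in> A)"

lemma cylinder_subset: "cylinder N I \<subseteq> inf_words N"
  by (auto simp: cylinder_def)

lemma cylinder_Nil [simp]: "cylinder N [] = inf_words N"
  by (auto simp: cylinder_def)

lemma cylinder_invalid: "\<not> set I \<subseteq> {..<N} \<Longrightarrow> cylinder N I = {}"
  by (auto simp: cylinder_def inf_words_iff in_set_conv_nth) metis

lemma determined_by_prefix_cylinder: "determined_by_prefix N (length I) (cylinder N I)"
  by (auto simp: determined_by_prefix_def cylinder_def)

lemma determined_by_prefix_mono: "determined_by_prefix N n A \<Longrightarrow> n \<le> m \<Longrightarrow> determined_by_prefix N m A"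
  unfolding determined_by_prefix_def by (meson less_le_trans)

lemma determined_by_prefix_Diff: "determined_by_prefix N n A \<Longrightarrow> determined_by_prefix N n (inf_words N - A)"
  unfolding determined_by_prefix_def by (metis Diff_iff Diff_subset)

lemma determined_by_prefix_Un: "determined_by_prefix N n A \<Longrightarrow> determined_by_prefix N n B \<Longrightarrow>
    determined_by_prefix N n (A \<union> B)"
  unfolding determined_by_prefix_def by blast

lemma algebra_determined_by_prefix: "algebra (inf_words N) {A. \<exists>n. determined_by_prefix N n A}"
  unfolding algebra_iff_Un
proof (intro conjI ballI)
  show "{} \<in> {A. \<exists>n. determined_by_prefix N n A}"
    by (auto simp: determined_by_prefix_def)
  fix A B assume "A \<in> {A. \<exists>n. determined_by_prefix N n A}" "B \<in> {A. \<exists>n. determined_by_prefix N n A}"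
  then obtain n m where "determined_by_prefix N n A" "determined_by_prefix N m B" by blast
  then have "determined_by_prefix N (max n m) (A \<union> B)"
    by (intro determined_by_prefix_Un) (erule determined_by_prefix_mono, simp)+
  then show "A \<union> B \<in> {A. \<exists>n. determined_by_prefix N n A}" by blast
  show "inf_words N - A \<in> {A. \<exists>n. determined_by_prefix N n A}"
    using \<open>determined_by_prefix N n A\<close> determined_by_prefix_Diff by blast
qed (auto simp: determined_by_prefix_def)

lemma openin_word_topology_iff:
  "openin (word_topology N) U \<longleftrightarrow>
     U \<subseteq> inf_words N \<and> (\<forall>\<omega>\<in>U. \<exists>n. cylinder N (map \<omega> [0..<n]) \<subseteq> U)"
  (is "_ \<longleftrightarrow> ?R")
proof
  assume U: "openin (word_topology N) U"
  show ?R
  proof (intro conjI ballI)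
    show "U \<subseteq> inf_words N"
      using openin_subset[OF U] by (simp add: inf_words_def)
    fix \<omega> assume "\<omega> \<in> U"
    with U obtain V where fin: "finite {k. V k \<noteq> {..<N}}"
      and \<omega>: "\<And>k. \<omega> k \<in> V k" and sub: "Pi\<^sub>E UNIV V \<subseteq> U"
      unfolding word_topology_def openin_product_topology_alt by fastforce
    obtain n where n: "\<And>k. V k \<noteq> {..<N} \<Longrightarrow> k < n"
      using fin unfolding finite_nat_iff_bounded by auto
    have "cylinder N (map \<omega> [0..<n]) \<subseteq> Pi\<^sub>E UNIV V"
    proof
      fix \<eta> assume "\<eta> \<in> cylinder N (map \<omega> [0..<n])"
      then have "\<forall>k. \<eta> k \<in> V k"
        using n \<omega> by (auto simp: cylinder_def inf_words_iff) (metis lessThan_iff)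
      then show "\<eta> \<in> Pi\<^sub>E UNIV V" by auto
    qed
    with sub show "\<exists>n. cylinder N (map \<omega> [0..<n]) \<subseteq> U" by blast
  qed
next
  assume R: ?R
  have op: "openin (word_topology N) (cylinder N I)" if "set I \<subseteq> {..<N}" for I
  proof -
    have "cylinder N I = Pi\<^sub>E UNIV (\<lambda>k. if k < length I then {I ! k} else {..<N})"
    proof (rule Set.set_eqI)
      have lt: "\<And>k. k < length I \<Longrightarrow> I ! k < N" using that nth_mem by blast
      show "\<eta> \<in> cylinder N I \<longleftrightarrow> \<eta> \<in> Pi\<^sub>E UNIV (\<lambda>k. if k < length I then {I ! k} else {..<N})" for \<eta>
        unfolding cylinder_def inf_words_iff PiE_UNIV_domain
        by (simp add: Pi_iff) (metis lt lessThan_iff singletonD singletonI)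
    qed
    moreover have "openin (word_topology N) (Pi\<^sub>E UNIV (\<lambda>k. if k < length I then {I ! k} else {..<N}))"
      unfolding word_topology_def
    proof (intro product_topology_basis)
      show "finite {i. (if i < length I then {I ! i} else {..<N}) \<noteq> topspace (discrete_topology {..<N})}"
        by (rule finite_subset[of _ "{..<length I}"]) auto
      show "openin (discrete_topology {..<N}) (if i < length I then {I ! i} else {..<N})" for i
        using that nth_mem by fastforce
    qed
    ultimately show ?thesis by simp
  qed
  show "openin (word_topology N) U"
    unfolding openin_subopen[of _ U]
  proof
    fix \<omega> assume "\<omega> \<in> U"
    with R obtain n where n: "cylinder N (map \<omega> [0..<n]) \<subseteq> U" and \<omega>: "\<omega> \<in> inf_words N" by blast
    then have "set (map \<omega> [0..<n]) \<subseteq> {..<N}" by (auto simp: inf_words_iff)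
    moreover have "\<omega> \<in> cylinder N (map \<omega> [0..<n])" using \<omega> by (simp add: cylinder_def)
    ultimately show "\<exists>T. openin (word_topology N) T \<and> \<omega> \<in> T \<and> T \<subseteq> U"
      using op n by blast
  qed
qed

lemma openin_determined_by_prefix:
  assumes "determined_by_prefix N n A"
  shows "openin (word_topology N) A"
  unfolding openin_word_topology_iff
proof (intro conjI ballI)
  fix \<omega> assume "\<omega> \<in> A"
  then have "cylinder N (map \<omega> [0..<n]) \<subseteq> A"
    using assms by (auto simp: determined_by_prefix_def cylinder_def)
  then show "\<exists>n. cylinder N (map \<omega> [0..<n]) \<subseteq> A" by blast
qed (use assms in \<open>simp add: determined_by_prefix_def\<close>)

lemma closedin_determined_by_prefix:
  assumes "determined_by_prefix N n A"
  shows "closedin (word_topology N) A"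
  unfolding closedin_def
  using assms openin_determined_by_prefix[OF determined_by_prefix_Diff[OF assms]]
  by (simp add: inf_words_def[symmetric]) (simp add: determined_by_prefix_def)

lemma compact_word_topology: "compact_space (word_topology N)"
  by (simp add: word_topology_def compact_space_product_topology compact_space_discrete_topology)

lemma opens_subset_Pow: "{A. openin (word_topology N) A} \<subseteq> Pow (inf_words N)"
  by (auto simp: openin_word_topology_iff)

lemma space_word_borel [simp]: "space (word_borel N) = inf_words N"
  by (simp add: word_borel_def space_measure_of[OF opens_subset_Pow])

lemma sets_word_borel_subset: "A \<in> sets (word_borel N) \<Longrightarrow> A \<subseteq> inf_words N"
  using sets.sets_into_space by fastforce

lemma determined_by_prefix_sets: "determined_by_prefix N n A \<Longrightarrow> A \<in> sets (word_borel N)"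
  unfolding word_borel_def
  using openin_determined_by_prefix opens_subset_Pow by (auto simp: sets_measure_of)

lemma cylinder_sets [simp]: "cylinder N I \<in> sets (word_borel N)"
  using determined_by_prefix_cylinder by (rule determined_by_prefix_sets)

text \<open>An open set is the union of the cylinders that it contains, and there are only countably many
  finite words.\<close>

lemma sets_word_borel: "sets (word_borel N) = sigma_sets (inf_words N) (range (cylinder N))"
proof
  have "range (cylinder N) \<subseteq> sets (word_borel N)" by auto
  from sets.sigma_sets_subset[OF this]
  show "sigma_sets (inf_words N) (range (cylinder N)) \<subseteq> sets (word_borel N)" by simp
  have "U \<in> sigma_sets (inf_words N) (range (cylinder N))" if "openin (word_topology N) U" for U
  proof -
    have "U = \<Union> (cylinder N ` {I. cylinder N I \<subseteq> U})"
    proof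
      show "U \<subseteq> \<Union> (cylinder N ` {I. cylinder N I \<subseteq> U})"
      proof
        fix \<omega> assume "\<omega> \<in> U"
        with that obtain n where n: "cylinder N (map \<omega> [0..<n]) \<subseteq> U" "\<omega> \<in> inf_words N"
          unfolding openin_word_topology_iff by blast
        moreover have "\<omega> \<in> cylinder N (map \<omega> [0..<n])" using n by (simp add: cylinder_def)
        ultimately show "\<omega> \<in> \<Union> (cylinder N ` {I. cylinder N I \<subseteq> U})" by blast
      qed
    qed blast
    moreover have "\<Union> (cylinder N ` {I. cylinder N I \<subseteq> U}) \<in> sigma_sets (inf_words N) (range (cylinder N))"
      by (rule sigma_sets_UNION) (auto intro: sigma_sets.Basic)
    ultimately show ?thesis by simp
  qed
  then show "sets (word_borel N) \<subseteq> sigma_sets (inf_words N) (range (cylinder N))"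
    unfolding word_borel_def sets_measure_of[OF opens_subset_Pow]
    by (intro sigma_sets_mono) auto
qed

text \<open>Two cylinders are nested or disjoint. The empty set is itself a cylinder, of a word that has a
  letter outside the alphabet, so the family of all cylinders is closed under intersection.\<close>

lemma cylinder_Int: "\<exists>K. cylinder N I \<inter> cylinder N J = cylinder N K"
proof -
  have *: "\<exists>K. cylinder N I \<inter> cylinder N J = cylinder N K" if "length I \<le> length J" for I J
  proof (cases "cylinder N I \<inter> cylinder N J = {}")
    case True
    then show ?thesis
      using cylinder_invalid[of "[N]" N] by (metis lessThan_iff less_irrefl list.set_intros(1) subsetD)
  next
    case False
    then obtain \<eta> where "\<eta> \<in> cylinder N I" "\<eta> \<in> cylinder N J" by blast
    then have "\<And>k. k < length I \<Longrightarrow> I ! k = J ! k" using that by (simp add: cylinder_def)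
    then have "cylinder N I \<inter> cylinder N J = cylinder N J" using that by (auto simp: cylinder_def)
    then show ?thesis by blast
  qed
  show ?thesis using *[of I J] *[of J I] by (metis Int_commute linear)
qed

lemma Int_stable_cylinders: "Int_stable (range (cylinder N))"
  unfolding Int_stable_def using cylinder_Int by blast

text \<open>The \<open>\<pi>\<close>-\<open>\<lambda>\<close> theorem for the cylinder sets, as an induction rule. The cylinders of words with
  invalid letters are empty, hence the separate case.\<close>

lemma word_borel_induct_disjoint [consumes 1, case_names cylinder compl union empty]:
  assumes "A \<in> sets (word_borel N)"
    and "\<And>I. set I \<subseteq> {..<N} \<Longrightarrow> Q (cylinder N I)"
    and "\<And>A. A \<in> sets (word_borel N) \<Longrightarrow> Q A \<Longrightarrow> Q (inf_words N - A)"
    and "\<And>A :: nat \<Rightarrow> _. disjoint_family A \<Longrightarrow> range A \<subseteq> sets (word_borel N) \<Longrightarrow>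
           (\<And>n. Q (A n)) \<Longrightarrow> Q (\<Union>n. A n)"
    and "Q {}"
  shows "Q A"
proof -
  have "range (cylinder N) \<subseteq> Pow (inf_words N)" using cylinder_subset by blast
  with Int_stable_cylinders show ?thesis
    using assms(1)[unfolded sets_word_borel]
  proof (induction rule: sigma_sets_induct_disjoint)
    case (basic A)
    then obtain I where "A = cylinder N I" by blast
    with assms(2,5) show ?case by (cases "set I \<subseteq> {..<N}") (auto simp: cylinder_invalid)
  qed (use assms in \<open>auto simp: sets_word_borel[symmetric]\<close>)
qed

lemma in_cylinder_Cons: "\<omega> \<in> cylinder N (j # I) \<longleftrightarrow> \<omega> 0 = j \<and> j < N \<and> shift \<omega> \<in> cylinder N I"
proof
  show "\<omega> \<in> cylinder N (j # I) \<Longrightarrow> \<omega> 0 = j \<and> j < N \<and> shift \<omega> \<in> cylinder N I"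
    by (fastforce simp: cylinder_def inf_words_iff shift_def)
  assume *: "\<omega> 0 = j \<and> j < N \<and> shift \<omega> \<in> cylinder N I"
  have "\<omega> k < N" for k
    using * by (cases k) (auto simp: cylinder_def inf_words_iff shift_def)
  moreover have "\<omega> k = (j # I) ! k" if "k < length (j # I)" for k
    using * that by (cases k) (auto simp: cylinder_def shift_def)
  ultimately show "\<omega> \<in> cylinder N (j # I)" by (auto simp: cylinder_def inf_words_iff)
qed

lemma shift_inf_words: "\<omega> \<in> inf_words N \<Longrightarrow> shift \<omega> \<in> inf_words N"
  by (simp add: inf_words_iff shift_def)

lemma branch_inf_words: "i < N \<Longrightarrow> \<omega> \<in> inf_words N \<Longrightarrow> branch i \<omega> \<in> inf_words N"
  by (simp add: inf_words_iff branch_def split: nat.split)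

lemma shift_branch [simp]: "shift (branch i \<omega>) = \<omega>"
  by (simp add: shift_def branch_def)

lemma inj_branch: "inj (branch i)"
  by (rule inj_on_inverseI[of _ shift]) simp

lemma branch_0 [simp]: "branch i \<omega> 0 = i"
  by (simp add: branch_def)

lemma branch_shift: "branch (\<omega> 0) (shift \<omega>) = \<omega>"
  by (auto simp: shift_def branch_def split: nat.split)

lemma measurable_shift: "shift \<in> measurable (word_borel N) (word_borel N)"
proof (rule measurable_sigma_sets[OF sets_word_borel])
  show "range (cylinder N) \<subseteq> Pow (inf_words N)" using cylinder_subset by blast
  show "shift \<in> space (word_borel N) \<rightarrow> inf_words N" using shift_inf_words by auto
  fix B assume "B \<in> range (cylinder N)"
  then obtain I where "B = cylinder N I" by blast
  moreover have "shift \<omega> \<in> cylinder N I \<longleftrightarrow> (\<exists>j<N. \<omega> \<in> cylinder N (j # I))" if "\<omega> \<in> inf_words N" for \<omega>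
    using that by (auto simp: in_cylinder_Cons inf_words_iff)
  moreover have "cylinder N (j # I) \<subseteq> inf_words N" for j by (rule cylinder_subset)
  ultimately have "shift -` B \<inter> space (word_borel N) = (\<Union>j<N. cylinder N (j # I))"
    unfolding space_word_borel by blast
  then show "shift -` B \<inter> space (word_borel N) \<in> sets (word_borel N)" by auto
qed

lemma measurable_branch:
  assumes "i < N"
  shows "branch i \<in> measurable (word_borel N) (word_borel N)"
proof (rule measurable_sigma_sets[OF sets_word_borel])
  show "range (cylinder N) \<subseteq> Pow (inf_words N)" using cylinder_subset by blast
  show "branch i \<in> space (word_borel N) \<rightarrow> inf_words N" using branch_inf_words[OF assms] by auto
  fix B assume "B \<in> range (cylinder N)"
  then obtain I where B: "B = cylinder N I" by blast
  show "branch i -` B \<inter> space (word_borel N) \<in> sets (word_borel N)"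
  proof (cases I)
    case Nil
    then have "branch i -` B \<inter> space (word_borel N) = inf_words N"
      using B branch_inf_words[OF assms] by auto
    then show ?thesis using sets.top[of "word_borel N"] by simp
  next
    case (Cons j J)
    then have "branch i -` B \<inter> space (word_borel N) = (if i = j then cylinder N J else {})"
      using B assms cylinder_subset[of N J] by (auto simp: in_cylinder_Cons)
    then show ?thesis by simp
  qed
qed

text \<open>Images under a branch are preimages under the shift, cut down to a cylinder; hence they are
  measurable.\<close>

lemma branch_image:
  assumes "i < N" "A \<subseteq> inf_words N"
  shows "branch i ` A = cylinder N [i] \<inter> (shift -` A \<inter> inf_words N)"
proof
  show "branch i ` A \<subseteq> cylinder N [i] \<inter> (shift -` A \<inter> inf_words N)"
    using assms branch_inf_words by (auto simp: in_cylinder_Cons)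
  show "cylinder N [i] \<inter> (shift -` A \<inter> inf_words N) \<subseteq> branch i ` A"
  proof
    fix \<omega> assume "\<omega> \<in> cylinder N [i] \<inter> (shift -` A \<inter> inf_words N)"
    then have "\<omega> = branch i (shift \<omega>)" "shift \<omega> \<in> A"
      using branch_shift[of \<omega>] by (auto simp: in_cylinder_Cons)
    then show "\<omega> \<in> branch i ` A" by blast
  qed
qed

lemma branch_image_sets:
  assumes "i < N" "A \<in> sets (word_borel N)"
  shows "branch i ` A \<in> sets (word_borel N)"
  using measurable_sets[OF measurable_shift assms(2)]
  by (simp add: branch_image[OF assms(1) sets_word_borel_subset[OF assms(2)]] sets.Int)

section \<open>Measures from consistent weights on words\<close>

lemma finite_fin_words: "finite (fin_words N n)"
  using finite_lists_length_eq[of "{..<N}" n] by (simp add: fin_words_def conj_commute)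

lemma sum_fin_words_Suc:
  "(\<Sum>I\<in>fin_words N (Suc n). g I) = (\<Sum>I\<in>fin_words N n. \<Sum>j<N. g (I @ [j]))"
proof -
  have "bij_betw (\<lambda>(I, j). I @ [j]) (fin_words N n \<times> {..<N}) (fin_words N (Suc n))"
    unfolding bij_betw_def
  proof
    show "(\<lambda>(I, j). I @ [j]) ` (fin_words N n \<times> {..<N}) = fin_words N (Suc n)"
    proof
      show "fin_words N (Suc n) \<subseteq> (\<lambda>(I, j). I @ [j]) ` (fin_words N n \<times> {..<N})"
      proof
        fix I assume "I \<in> fin_words N (Suc n)"
        then show "I \<in> (\<lambda>(I, j). I @ [j]) ` (fin_words N n \<times> {..<N})"
          by (cases I rule: rev_cases) (force simp: fin_words_def)+
      qed
    qed (auto simp: fin_words_def)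
  qed (auto simp: inj_on_def)
  from sum.reindex_bij_betw[OF this, of g] show ?thesis
    by (simp add: sum.cartesian_product split_def)
qed

lemma pad_inf_words: "N > 0 \<Longrightarrow> set I \<subseteq> {..<N} \<Longrightarrow> pad I \<in> inf_words N"
  using nth_mem by (auto simp: inf_words_iff pad_def)

lemma pad_in_cylinder_iff:
  assumes "N > 0" "I \<in> fin_words N n" "J \<in> fin_words N n"
  shows "pad J \<in> cylinder N I \<longleftrightarrow> J = I"
  using assms pad_inf_words[of N J]
  by (auto simp: fin_words_def cylinder_def pad_def intro!: nth_equalityI)

text \<open>A consistent system of weights on words is a measure. The content of a clopen set \<open>A\<close> is the
  total weight of those words \<open>I\<close> of length \<open>n\<close> with \<open>pad I \<in> A\<close>, for any large \<open>n\<close>; by consistency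
  this does not change with \<open>n\<close>, so a limit over \<open>n\<close> defines it without choosing a level.
  Caratheodory's theorem needs continuity at the empty set, which compactness makes trivial: a
  decreasing sequence of clopen sets with empty intersection is eventually empty.\<close>

lemma measure_from_weights:
  fixes w :: "nat list \<Rightarrow> real"
  assumes N: "N > 0" and nonneg: "\<And>I. 0 \<le> w I"
    and consistent: "\<And>I. set I \<subseteq> {..<N} \<Longrightarrow> (\<Sum>j<N. w (I @ [j])) = w I"
  shows "\<exists>\<mu>. sets \<mu> = sets (word_borel N) \<and>
           (\<forall>I. set I \<subseteq> {..<N} \<longrightarrow> emeasure \<mu> (cylinder N I) = ennreal (w I))"
proof -
  define G where "G = {A. \<exists>n. determined_by_prefix N n A}"
  define c where "c n A = (\<Sum>I\<in>fin_words N n. if pad I \<in> A then w I else 0)" for n A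
  define f where "f A = lim (\<lambda>n. c n A)" for A
  have step: "c (Suc m) A = c m A" if "determined_by_prefix N m A" for m A
  proof -
    have "c (Suc m) A = (\<Sum>I\<in>fin_words N m. \<Sum>j<N. if pad (I @ [j]) \<in> A then w (I @ [j]) else 0)"
      by (simp add: c_def sum_fin_words_Suc)
    also have "\<dots> = (\<Sum>I\<in>fin_words N m. \<Sum>j<N. if pad I \<in> A then w (I @ [j]) else 0)"
    proof (intro sum.cong refl)
      fix I j assume "I \<in> fin_words N m" "j \<in> {..<N}"
      then have "pad I \<in> inf_words N" "pad (I @ [j]) \<in> inf_words N" "\<forall>k<m. pad (I @ [j]) k = pad I k"
        using N by (auto intro!: pad_inf_words simp: fin_words_def) (auto simp: pad_def nth_append)
      then have "pad (I @ [j]) \<in> A \<longleftrightarrow> pad I \<in> A"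
        using that unfolding determined_by_prefix_def by metis
      then show "(if pad (I @ [j]) \<in> A then w (I @ [j]) else 0) = (if pad I \<in> A then w (I @ [j]) else 0)"
        by simp
    qed
    also have "\<dots> = c m A"
      unfolding c_def by (intro sum.cong refl) (auto simp: fin_words_def consistent)
    finally show ?thesis .
  qed
  have c_eq: "c m A = c n A" if "determined_by_prefix N n A" "n \<le> m" for n m A
    using that(2)
  proof (induction rule: dec_induct)
    case (step m)
    then show ?case using \<open>\<And>m A. determined_by_prefix N m A \<Longrightarrow> c (Suc m) A = c m A\<close>
      determined_by_prefix_mono[OF that(1)] by simp
  qed simp
  have f_eq: "f A = c n A" if "determined_by_prefix N n A" for n A
    unfolding f_def
    by (intro limI tendsto_eventually eventually_sequentiallyI[of n] c_eq[OF that])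
  have f_nonneg: "0 \<le> f A" if "A \<in> G" for A
    using that nonneg by (auto simp: G_def f_eq c_def intro!: sum_nonneg)
  interpret algebra "inf_words N" G
    unfolding G_def by (rule algebra_determined_by_prefix)
  have "\<exists>\<mu> :: (nat \<Rightarrow> nat) set \<Rightarrow> ennreal. (\<forall>s\<in>G. \<mu> s = ennreal (f s)) \<and>
      measure_space (inf_words N) (sigma_sets (inf_words N) G) \<mu>"
  proof (rule caratheodory_empty_continuous)
    have "determined_by_prefix N 0 {}" by (simp add: determined_by_prefix_def)
    from f_eq[OF this] have "f {} = 0" by (simp add: c_def)
    then show "positive G (\<lambda>s. ennreal (f s))" by (simp add: positive_def)
    show "additive G (\<lambda>s. ennreal (f s))"
      unfolding additive_def
    proof (intro ballI impI)
      fix A B assume AB: "A \<in> G" "B \<in> G" "A \<inter> B = {}"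
      then obtain n m where "determined_by_prefix N n A" "determined_by_prefix N m B"
        by (auto simp: G_def)
      then have d: "determined_by_prefix N (max n m) A" "determined_by_prefix N (max n m) B"
        using determined_by_prefix_mono by (meson max.cobounded1 max.cobounded2)+
      have "f (A \<union> B) = f A + f B"
        unfolding f_eq[OF d(1)] f_eq[OF d(2)] f_eq[OF determined_by_prefix_Un[OF d]] c_def
          sum.distrib[symmetric]
        using AB by (intro sum.cong) auto
      then show "ennreal (f (A \<union> B)) = ennreal (f A) + ennreal (f B)"
        using AB f_nonneg by (simp add: ennreal_plus)
    qed
    fix A :: "nat \<Rightarrow> (nat \<Rightarrow> nat) set"
    assume A: "range A \<subseteq> G" "decseq A" "(\<Inter>i. A i) = {}"
    have "\<exists>n. A n = {}"
    proof (rule ccontr)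
      assume "\<not> (\<exists>n. A n = {})"
      moreover have "closedin (word_topology N) (A n)" for n
        using A(1) closedin_determined_by_prefix by (auto simp: G_def)
      ultimately show False
        using compact_space_imp_nest[OF compact_word_topology, of N A] A by blast
    qed
    then obtain n where "A n = {}" by blast
    then have "A m = {}" if "m \<ge> n" for m
      using decseqD[OF A(2) that] by blast
    then show "(\<lambda>i. ennreal (f (A i))) \<longlonglongrightarrow> 0"
      using \<open>f {} = 0\<close> by (intro tendsto_eventually eventually_sequentiallyI[of n]) simp
  qed simp
  then obtain \<mu> where \<mu>: "\<And>s. s \<in> G \<Longrightarrow> \<mu> s = ennreal (f s)"
    and ms: "measure_space (inf_words N) (sigma_sets (inf_words N) G) \<mu>" by blast
  have GB: "sigma_sets (inf_words N) G = sets (word_borel N)"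
  proof
    show "sigma_sets (inf_words N) G \<subseteq> sets (word_borel N)"
      using sets.sigma_sets_subset[of G "word_borel N"] determined_by_prefix_sets by (auto simp: G_def)
    show "sets (word_borel N) \<subseteq> sigma_sets (inf_words N) G"
      unfolding sets_word_borel G_def
      using determined_by_prefix_cylinder by (intro sigma_sets_mono') blast
  qed
  define M where "M = measure_of (inf_words N) (sets (word_borel N)) \<mu>"
  have Pow: "sets (word_borel N) \<subseteq> Pow (inf_words N)" using sets_word_borel_subset by auto
  have sM: "sets M = sets (word_borel N)"
    unfolding M_def sets_measure_of[OF Pow] by (metis sets.sigma_sets_eq space_word_borel)
  have em: "emeasure M A = \<mu> A" if "A \<in> sets (word_borel N)" for A
  proof (rule emeasure_measure_of[OF M_def Pow])
    show "positive (sets M) \<mu>" "countably_additive (sets M) \<mu>"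
      using ms unfolding GB sM measure_space_def by auto
  qed (simp add: sM that)
  have "emeasure M (cylinder N I) = ennreal (w I)" if "set I \<subseteq> {..<N}" for I
  proof -
    have I: "I \<in> fin_words N (length I)" using that by (simp add: fin_words_def)
    have "f (cylinder N I) = (\<Sum>J\<in>fin_words N (length I). if J = I then w J else 0)"
      unfolding f_eq[OF determined_by_prefix_cylinder] c_def
      by (intro sum.cong refl) (simp add: pad_in_cylinder_iff[OF N I])
    also have "\<dots> = w I" using I by (simp add: finite_fin_words)
    finally show ?thesis
      using \<mu>[of "cylinder N I"] determined_by_prefix_cylinder by (auto simp: em G_def)
  qed
  with sM show ?thesis by blast
qed

section \<open>Integration against a projection-valued measure\<close>

lemma pvmD:
  assumes "pvm M P"
  shows pvm_projection: "A \<in> sets M \<Longrightarrow> projection_op (P A)"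
    and pvm_empty: "P {} = 0"
    and pvm_space: "P (space M) = id_blinfun"
    and pvm_Int: "A \<in> sets M \<Longrightarrow> B \<in> sets M \<Longrightarrow> P (A \<inter> B) = P A o\<^sub>L P B"
    and pvm_sums: "range F \<subseteq> sets M \<Longrightarrow> disjoint_family F \<Longrightarrow>
          (\<lambda>n. blinfun_apply (P (F n)) x) sums blinfun_apply (P (\<Union>n. F n)) x"
  using assms unfolding pvm_def by blast+

lemma pvm_bounded_ops: "pvm M P \<Longrightarrow> A \<in> sets M \<Longrightarrow> P A \<in> bounded_ops"
  using pvm_projection unfolding projection_op_def by blast

text \<open>Stated for an arbitrary strongly countably additive function, because the construction of a
  projection-valued measure derives multiplicativity from additivity.\<close>

lemma operator_additive_Un:
  assumes "P {} = 0"
    and sums: "\<And>F :: nat \<Rightarrow> _. range F \<subseteq> sets M \<Longrightarrow> disjoint_family F \<Longrightarrow>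
          (\<lambda>n. blinfun_apply (P (F n)) x) sums blinfun_apply (P (\<Union>n. F n)) x"
    and "A \<in> sets M" "B \<in> sets M" "A \<inter> B = {}"
  shows "blinfun_apply (P (A \<union> B)) x = blinfun_apply (P A) x + blinfun_apply (P B) x"
proof -
  have "disjoint_family (binaryset A B)" "range (binaryset A B) \<subseteq> sets M"
    using assms by (auto simp: disjoint_family_on_def binaryset_def)
  from sums[OF this(2,1)]
  have "(\<lambda>n. blinfun_apply (P (binaryset A B n)) x) sums blinfun_apply (P (A \<union> B)) x"
    by (simp add: UN_binaryset_eq)
  moreover have "(\<lambda>n. blinfun_apply (P (binaryset A B n)) x) sums
      (blinfun_apply (P A) x + blinfun_apply (P B) x)"
    by (rule binaryset_sums) (simp add: assms(1))
  ultimately show ?thesis by (rule sums_unique2)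
qed

lemma pvm_Un:
  assumes "pvm M P" "A \<in> sets M" "B \<in> sets M" "A \<inter> B = {}"
  shows "P (A \<union> B) = P A + P B"
proof (rule blinfun_eqI)
  fix x
  have "blinfun_apply (P (A \<union> B)) x = blinfun_apply (P A) x + blinfun_apply (P B) x"
    using assms by (intro operator_additive_Un[of P M] pvm_empty[of M P] pvm_sums[of M P])
  then show "blinfun_apply (P (A \<union> B)) x = blinfun_apply (P A + P B) x"
    by (simp add: blinfun.add_left)
qed

lemma pvm_Diff:
  assumes "pvm M P" "A \<in> sets M"
  shows "P (space M - A) = id_blinfun - P A"
proof -
  have "P (A \<union> (space M - A)) = P A + P (space M - A)"
    using assms by (intro pvm_Un) auto
  moreover have "A \<union> (space M - A) = space M" using assms sets.sets_into_space by blast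
  ultimately show ?thesis using pvm_space[OF assms(1)] by (simp add: algebra_simps)
qed

lemma pvm_finite_UN:
  assumes P: "pvm M P" and "finite F" "\<And>i. i \<in> F \<Longrightarrow> A i \<in> sets M" "disjoint_family_on A F"
  shows "P (\<Union>i\<in>F. A i) = (\<Sum>i\<in>F. P (A i))"
  using assms(2-)
proof (induction F)
  case (insert i F)
  have "P (A i \<union> (\<Union>i\<in>F. A i)) = P (A i) + P (\<Union>i\<in>F. A i)"
    using insert.prems insert.hyps by (intro pvm_Un[OF P]) (auto simp: disjoint_family_on_def)
  also have "P (\<Union>i\<in>F. A i) = (\<Sum>i\<in>F. P (A i))"
    using insert.prems by (intro insert.IH) (auto simp: disjoint_family_on_def)
  finally show ?case using insert.hyps by simp
qed (simp add: pvm_empty[OF P])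

lemma sets_pvm_measure [simp, measurable_cong]: "sets (pvm_measure M P x) = sets M"
  by (simp add: pvm_measure_def sets_measure_of[OF sets.space_closed] sets.sigma_sets_eq)

lemma space_pvm_measure [simp]: "space (pvm_measure M P x) = space M"
  by (simp add: pvm_measure_def space_measure_of[OF sets.space_closed])

lemma emeasure_pvm_measure:
  fixes P :: "_ \<Rightarrow> ('a::chilbert_space \<Rightarrow>\<^sub>L 'a)"
  assumes P: "pvm M P" and A: "A \<in> sets M"
  shows "emeasure (pvm_measure M P x) A = ennreal ((norm (blinfun_apply (P A) x))\<^sup>2)"
proof -
  let ?\<mu> = "\<lambda>A. ennreal (Re (cinner (blinfun_apply (P A) x) x))"
  have Re_eq: "Re (cinner (blinfun_apply (P A) x) x) = (norm (blinfun_apply (P A) x))\<^sup>2"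
    if "A \<in> sets M" for A
    using cinner_projection[OF pvm_projection[OF P that]] by simp
  have "emeasure (pvm_measure M P x) A = ?\<mu> A"
  proof (rule emeasure_measure_of[OF pvm_measure_def sets.space_closed])
    show "positive (sets (pvm_measure M P x)) ?\<mu>"
      by (simp add: positive_def pvm_empty[OF P])
    show "countably_additive (sets (pvm_measure M P x)) ?\<mu>"
      unfolding countably_additive_def sets_pvm_measure
    proof (intro allI impI)
      fix F :: "nat \<Rightarrow> _"
      assume F: "range F \<subseteq> sets M" "disjoint_family F"
      have "bounded_linear (\<lambda>y. Re (cinner y x))"
        by (intro bounded_linear_compose[OF bounded_linear_Re] bounded_linear_cinner_left)
      from bounded_linear.sums[OF this pvm_sums[OF P F, of x]]
      show "(\<Sum>n. ?\<mu> (F n)) = ?\<mu> (\<Union>n. F n)"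
        using F by (intro suminf_ennreal_eq) (auto simp: Re_eq)
    qed
  qed (simp add: A)
  then show ?thesis by (simp add: Re_eq A)
qed

lemma finite_measure_pvm_measure:
  fixes P :: "_ \<Rightarrow> ('a::chilbert_space \<Rightarrow>\<^sub>L 'a)"
  shows "pvm M P \<Longrightarrow> finite_measure (pvm_measure M P x)"
  by (rule finite_measureI) (simp add: emeasure_pvm_measure)

lemma measure_pvm_measure:
  fixes P :: "_ \<Rightarrow> ('a::chilbert_space \<Rightarrow>\<^sub>L 'a)"
  shows "pvm M P \<Longrightarrow> A \<in> sets M \<Longrightarrow> measure (pvm_measure M P x) A = (norm (blinfun_apply (P A) x))\<^sup>2"
  by (simp add: measure_def emeasure_pvm_measure)

lemma has_pvm_integral_cong:
  assumes "\<And>\<omega>. \<omega> \<in> space M \<Longrightarrow> f \<omega> = g \<omega>"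
  shows "has_pvm_integral M P f T \<longleftrightarrow> has_pvm_integral M P g T"
proof -
  have "integrable (pvm_measure M P x) f = integrable (pvm_measure M P x) g"
    "(\<integral>\<omega>. f \<omega> \<partial>pvm_measure M P x) = (\<integral>\<omega>. g \<omega> \<partial>pvm_measure M P x)" for x
    using assms by (auto intro!: Bochner_Integration.integrable_cong Bochner_Integration.integral_cong)
  then show ?thesis by (simp add: has_pvm_integral_def)
qed

lemma has_pvm_integral_diff:
  "has_pvm_integral M P f T \<Longrightarrow> has_pvm_integral M P g R \<Longrightarrow>
     has_pvm_integral M P (\<lambda>\<omega>. f \<omega> - g \<omega>) (T - R)"
  unfolding has_pvm_integral_def
  by (auto simp: bounded_ops_intros blinfun.diff_left cinner_diff_left)

lemma has_pvm_integral_add: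
  "has_pvm_integral M P f T \<Longrightarrow> has_pvm_integral M P g R \<Longrightarrow>
     has_pvm_integral M P (\<lambda>\<omega>. f \<omega> + g \<omega>) (T + R)"
  unfolding has_pvm_integral_def
  by (auto simp: bounded_ops_intros blinfun.add_left cinner_add_left)

lemma has_pvm_integral_scale:
  "has_pvm_integral M P f T \<Longrightarrow> has_pvm_integral M P (\<lambda>\<omega>. c * f \<omega>) (scale_op c T)"
  unfolding has_pvm_integral_def
  by (auto simp: bounded_ops_intros scale_op.rep_eq cinner_scaleC_left)

lemma has_pvm_integral_sum:
  "(\<And>i. i \<in> F \<Longrightarrow> has_pvm_integral M P (f i) (T i)) \<Longrightarrow>
     has_pvm_integral M P (\<lambda>\<omega>. \<Sum>i\<in>F. f i \<omega>) (\<Sum>i\<in>F. T i)"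
  unfolding has_pvm_integral_def
  by (auto simp: bounded_ops_intros blinfun.sum_left cinner_sum_left)

lemma has_pvm_integral_indicator:
  fixes P :: "_ \<Rightarrow> ('a::chilbert_space \<Rightarrow>\<^sub>L 'a)"
  assumes P: "pvm M P" and A: "A \<in> sets M"
  shows "has_pvm_integral M P (indicator A) (P A)"
  unfolding has_pvm_integral_def
proof (intro conjI allI)
  fix x
  interpret finite_measure "pvm_measure M P x" using P by (rule finite_measure_pvm_measure)
  show "integrable (pvm_measure M P x) (indicator A :: _ \<Rightarrow> complex)"
    using A by (intro integrable_const_bound[where B = 1]) (auto simp: indicator_def)
  have "(\<integral>\<omega>. indicator A \<omega> \<partial>pvm_measure M P x)
      = (\<integral>\<omega>. complex_of_real (indicator A \<omega>) \<partial>pvm_measure M P x)"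
    by (intro Bochner_Integration.integral_cong) (auto simp: indicator_def)
  also have "\<dots> = complex_of_real (measure (pvm_measure M P x) A)"
    using A by (simp add: sets.Int_space_eq2)
  finally show "cinner (blinfun_apply (P A) x) x = (\<integral>\<omega>. indicator A \<omega> \<partial>pvm_measure M P x)"
    by (simp add: measure_pvm_measure[OF P A] cinner_projection[OF pvm_projection[OF P A]])
qed (rule pvm_bounded_ops[OF P A])

text \<open>Polarization bounds the sesquilinear form by \<open>c ((norm x)\<^sup>2 + (norm y)\<^sup>2)\<close>. Choosing \<open>y\<close> parallel to
  \<open>T x\<close> with the norm of \<open>x\<close> gives the bound for \<open>norm (T x)\<close>.\<close>

lemma norm_le_numerical_radius:
  fixes T :: "'a::complex_inner \<Rightarrow>\<^sub>L 'a"
  assumes T: "T \<in> bounded_ops" and "0 \<le> c"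
    and le: "\<And>x. cmod (cinner (blinfun_apply T x) x) \<le> c * (norm x)\<^sup>2"
  shows "norm T \<le> 2 * c"
proof (rule norm_blinfun_bound)
  fix x
  let ?q = "\<lambda>x. cinner (blinfun_apply T x) x"
  have sym: "cmod (cinner (blinfun_apply T x) y) \<le> c * ((norm x)\<^sup>2 + (norm y)\<^sup>2)" for y
  proof -
    have exp: "?q (x + u *\<^sub>C y) = ?q x + u * cnj u * ?q y + u * cinner (blinfun_apply T y) x
        + cnj u * cinner (blinfun_apply T x) y" for u
      by (simp add: blinfun.add_right bounded_opsD[OF T] cinner_add_left cinner_add_right
          cinner_scaleC_left cinner_scaleC_right distrib_left mult_ac)
    have "4 * cinner (blinfun_apply T x) y
        = ?q (x + 1 *\<^sub>C y) - ?q (x + (-1) *\<^sub>C y) + \<i> * ?q (x + \<i> *\<^sub>C y) - \<i> * ?q (x + (- \<i>) *\<^sub>C y)"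
      unfolding exp by (simp add: algebra_simps)
    then have "4 * cmod (cinner (blinfun_apply T x) y)
        = cmod (?q (x + 1 *\<^sub>C y) - ?q (x + (-1) *\<^sub>C y) + \<i> * ?q (x + \<i> *\<^sub>C y) - \<i> * ?q (x + (- \<i>) *\<^sub>C y))"
      by (metis norm_mult norm_numeral)
    also have "\<dots> \<le> cmod (?q (x + 1 *\<^sub>C y)) + cmod (?q (x + (-1) *\<^sub>C y))
        + cmod (\<i> * ?q (x + \<i> *\<^sub>C y)) + cmod (\<i> * ?q (x + (- \<i>) *\<^sub>C y))"
      by (smt (verit) norm_triangle_ineq norm_triangle_ineq4)
    also have "\<dots> \<le> c * (norm (x + 1 *\<^sub>C y))\<^sup>2 + c * (norm (x + (-1) *\<^sub>C y))\<^sup>2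
        + c * (norm (x + \<i> *\<^sub>C y))\<^sup>2 + c * (norm (x + (- \<i>) *\<^sub>C y))\<^sup>2"
      unfolding norm_mult norm_ii mult_1 by (intro add_mono le)
    also have "\<dots> = 4 * (c * ((norm x)\<^sup>2 + (norm y)\<^sup>2))"
      by (simp add: power2_norm_eq_inner inner_eq_Re_cinner cinner_add_left cinner_add_right
          cinner_scaleC_left cinner_scaleC_right algebra_simps)
    finally show ?thesis by simp
  qed
  show "norm (blinfun_apply T x) \<le> 2 * c * norm x"
  proof (cases "blinfun_apply T x = 0")
    case False
    define r where "r = norm x / norm (blinfun_apply T x)"
    have "cinner (blinfun_apply T x) (complex_of_real r *\<^sub>C blinfun_apply T x)
        = complex_of_real (r * (norm (blinfun_apply T x))\<^sup>2)"
      by (simp add: cinner_scaleC_right cinner_self)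
    moreover have "norm (complex_of_real r *\<^sub>C blinfun_apply T x) = norm x"
      using False by (simp add: norm_scaleC r_def norm_divide)
    ultimately have "\<bar>r * (norm (blinfun_apply T x))\<^sup>2\<bar> \<le> c * (2 * (norm x)\<^sup>2)"
      using sym[of "complex_of_real r *\<^sub>C blinfun_apply T x"]
      by (metis mult_2 norm_of_real)
    then have "norm x * norm (blinfun_apply T x) \<le> norm x * (2 * c * norm x)"
      using False by (simp add: r_def power2_eq_square mult_ac)
    moreover have "norm x > 0" using False by (auto simp: blinfun.zero_right)
    ultimately show ?thesis by simp
  qed (use \<open>0 \<le> c\<close> in simp)
qed (use \<open>0 \<le> c\<close> in simp)

lemma pvm_integral_norm_le:
  fixes P :: "_ \<Rightarrow> ('a::chilbert_space \<Rightarrow>\<^sub>L 'a)"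
  assumes P: "pvm M P" and T: "has_pvm_integral M P f T"
    and "0 \<le> c" and le: "\<And>\<omega>. \<omega> \<in> space M \<Longrightarrow> cmod (f \<omega>) \<le> c"
  shows "norm T \<le> 2 * c"
proof (rule norm_le_numerical_radius)
  show "T \<in> bounded_ops" using T by (simp add: has_pvm_integral_def)
  fix x
  interpret finite_measure "pvm_measure M P x" using P by (rule finite_measure_pvm_measure)
  have int: "integrable (pvm_measure M P x) f" using T by (simp add: has_pvm_integral_def)
  have "cmod (cinner (blinfun_apply T x) x) = cmod (\<integral>\<omega>. f \<omega> \<partial>pvm_measure M P x)"
    using T by (simp add: has_pvm_integral_def)
  also have "\<dots> \<le> (\<integral>\<omega>. cmod (f \<omega>) \<partial>pvm_measure M P x)" by simp
  also have "\<dots> \<le> (\<integral>\<omega>. c \<partial>pvm_measure M P x)"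
    using int le by (intro integral_mono) auto
  also have "\<dots> = c * (norm x)\<^sup>2"
    using measure_pvm_measure[OF P sets.top, of x] by (simp add: pvm_space[OF P])
  finally show "cmod (cinner (blinfun_apply T x) x) \<le> c * (norm x)\<^sup>2" .
qed fact

lemma closed_bounded_ops: "closed (bounded_ops :: ('a::complex_inner \<Rightarrow>\<^sub>L 'a) set)"
proof -
  have "closed {T :: 'a \<Rightarrow>\<^sub>L 'a. blinfun_apply T (c *\<^sub>C x) = c *\<^sub>C blinfun_apply T x}" for c x
    by (intro closed_Collect_eq continuous_intros
        bounded_linear.continuous_on[OF bounded_linear_scaleC])
  then have "closed (\<Inter>c. \<Inter>x. {T :: 'a \<Rightarrow>\<^sub>L 'a. blinfun_apply T (c *\<^sub>C x) = c *\<^sub>C blinfun_apply T x})"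
    by blast
  moreover have "bounded_ops = (\<Inter>c. \<Inter>x. {T :: 'a \<Rightarrow>\<^sub>L 'a. blinfun_apply T (c *\<^sub>C x) = c *\<^sub>C blinfun_apply T x})"
    by (auto simp: bounded_ops_def)
  ultimately show ?thesis by simp
qed

text \<open>Uniform convergence of the integrands is norm convergence of the integrals, by the
  preceding bound applied to differences.\<close>

lemma pvm_integral_uniform_limit:
  fixes P :: "'w set \<Rightarrow> ('a::chilbert_space \<Rightarrow>\<^sub>L 'a)"
  assumes P: "pvm M P" and T: "\<And>n. has_pvm_integral M P (F n) (T n)"
    and f: "f \<in> borel_measurable M"
    and F: "\<And>n \<omega>. \<omega> \<in> space M \<Longrightarrow> cmod (F n \<omega> - f \<omega>) \<le> inverse (real (Suc n))"
    and B: "\<And>\<omega>. \<omega> \<in> space M \<Longrightarrow> cmod (f \<omega>) \<le> B"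
  shows "\<exists>T. has_pvm_integral M P f T"
proof -
  have lim0: "(\<lambda>n. inverse (real (Suc n))) \<longlonglongrightarrow> 0" by (rule LIMSEQ_inverse_real_of_nat)
  have le: "norm (T n - T m) \<le> 2 * (inverse (real (Suc n)) + inverse (real (Suc m)))" for n m
  proof (rule pvm_integral_norm_le[OF P has_pvm_integral_diff[OF T T]])
    show "cmod (F n \<omega> - F m \<omega>) \<le> inverse (real (Suc n)) + inverse (real (Suc m))"
      if "\<omega> \<in> space M" for \<omega>
    proof -
      have "F n \<omega> - F m \<omega> = (F n \<omega> - f \<omega>) - (F m \<omega> - f \<omega>)" by simp
      then have "cmod (F n \<omega> - F m \<omega>) \<le> cmod (F n \<omega> - f \<omega>) + cmod (F m \<omega> - f \<omega>)"
        by (metis norm_triangle_ineq4)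
      with F[OF that, of n] F[OF that, of m] show ?thesis by linarith
    qed
  qed simp
  have "Cauchy T"
  proof (rule metric_CauchyI)
    fix e :: real assume "e > 0"
    then obtain K where K: "\<And>n. n \<ge> K \<Longrightarrow> inverse (real (Suc n)) < e / 4"
      using order_tendstoD(2)[OF lim0, of "e / 4"] by (auto simp: eventually_sequentially)
    have "dist (T n) (T m) < e" if "n \<ge> K" "m \<ge> K" for n m
      using le[of n m] K[OF that(1)] K[OF that(2)] by (simp add: dist_norm)
    then show "\<exists>K. \<forall>n\<ge>K. \<forall>m\<ge>K. dist (T n) (T m) < e" by blast
  qed
  then obtain T' where T': "T \<longlonglongrightarrow> T'" using Cauchy_convergent convergent_def by blast
  have "has_pvm_integral M P f T'"
    unfolding has_pvm_integral_def
  proof (intro conjI allI)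
    show "T' \<in> bounded_ops"
      using closed_sequentially[OF closed_bounded_ops _ T'] T by (simp add: has_pvm_integral_def)
    fix x
    interpret finite_measure "pvm_measure M P x" using P by (rule finite_measure_pvm_measure)
    show "integrable (pvm_measure M P x) f"
      using f B by (intro integrable_const_bound[where B = B]) auto
    have "(\<lambda>n. cinner (blinfun_apply (T n) x) x) \<longlonglongrightarrow> cinner (blinfun_apply T' x) x"
      by (intro bounded_linear.tendsto[OF bounded_linear_cinner_left] tendsto_intros T')
    moreover have "(\<lambda>n. \<integral>\<omega>. F n \<omega> \<partial>pvm_measure M P x) \<longlonglongrightarrow> (\<integral>\<omega>. f \<omega> \<partial>pvm_measure M P x)"
    proof (rule integral_dominated_convergence[where w = "\<lambda>_. B + 1"])
      show "F n \<in> borel_measurable (pvm_measure M P x)" for n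
        using T[of n] by (simp add: has_pvm_integral_def borel_measurable_integrable)
      show "AE \<omega> in pvm_measure M P x. (\<lambda>n. F n \<omega>) \<longlonglongrightarrow> f \<omega>"
      proof (rule AE_I2)
        fix \<omega> assume "\<omega> \<in> space (pvm_measure M P x)"
        then have "\<forall>n. norm (F n \<omega> - f \<omega>) \<le> inverse (real (Suc n))" using F by simp
        then have "(\<lambda>n. F n \<omega> - f \<omega>) \<longlonglongrightarrow> 0"
          by (rule Lim_null_comparison[OF always_eventually lim0])
        then show "(\<lambda>n. F n \<omega>) \<longlonglongrightarrow> f \<omega>" by (rule LIM_zero_cancel)
      qed
      show "AE \<omega> in pvm_measure M P x. norm (F n \<omega>) \<le> B + 1" for n
      proof (rule AE_I2)
        fix \<omega> assume "\<omega> \<in> space (pvm_measure M P x)"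
        then have "cmod (F n \<omega> - f \<omega>) \<le> inverse (real (Suc n))" "cmod (f \<omega>) \<le> B"
          using F B by auto
        moreover have "inverse (real (Suc n)) \<le> 1" by (simp add: inverse_le_1_iff)
        ultimately show "norm (F n \<omega>) \<le> B + 1"
          using norm_triangle_sub[of "F n \<omega>" "f \<omega>"] by linarith
      qed
    qed (use f in auto)
    ultimately show "cinner (blinfun_apply T' x) x = (\<integral>\<omega>. f \<omega> \<partial>pvm_measure M P x)"
      using T LIMSEQ_unique by (simp add: has_pvm_integral_def)
  qed
  then show ?thesis ..
qed

text \<open>Rounding \<open>g\<close> down to a multiple of \<open>1 / (n + 1)\<close> gives simple functions that converge
  uniformly to \<open>g\<close>.\<close>

lemma has_pvm_integral_real_exists:
  fixes P :: "'w set \<Rightarrow> ('a::chilbert_space \<Rightarrow>\<^sub>L 'a)" and g :: "'w \<Rightarrow> real"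
  assumes P: "pvm M P" and g: "g \<in> borel_measurable M"
    and B: "\<And>\<omega>. \<omega> \<in> space M \<Longrightarrow> \<bar>g \<omega>\<bar> \<le> B"
  shows "\<exists>T. has_pvm_integral M P (\<lambda>\<omega>. complex_of_real (g \<omega>)) T"
proof -
  define F where "F n \<omega> = real_of_int \<lfloor>real (Suc n) * g \<omega>\<rfloor> / real (Suc n)" for n \<omega>
  define A where "A n k = {\<omega> \<in> space M. \<lfloor>real (Suc n) * g \<omega>\<rfloor> = k}" for n k
  define R where "R n = (\<Sum>k\<in>{- \<lceil>real (Suc n) * B\<rceil>..\<lceil>real (Suc n) * B\<rceil>}.
      scale_op (complex_of_real (real_of_int k / real (Suc n))) (P (A n k)))" for n
  have A: "A n k \<in> sets M" for n k
    unfolding A_def using g by measurable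
  have "has_pvm_integral M P (\<lambda>\<omega>. complex_of_real (F n \<omega>)) (R n)" for n
  proof -
    let ?K = "\<lceil>real (Suc n) * B\<rceil>"
    have "has_pvm_integral M P
        (\<lambda>\<omega>. \<Sum>k\<in>{-?K..?K}. complex_of_real (real_of_int k / real (Suc n)) * indicator (A n k) \<omega>) (R n)"
      unfolding R_def
      by (intro has_pvm_integral_sum has_pvm_integral_scale has_pvm_integral_indicator P A)
    moreover have "(\<Sum>k\<in>{-?K..?K}. complex_of_real (real_of_int k / real (Suc n)) * indicator (A n k) \<omega>)
        = complex_of_real (F n \<omega>)" if "\<omega> \<in> space M" for \<omega>
    proof -
      let ?k = "\<lfloor>real (Suc n) * g \<omega>\<rfloor>"
      have floor_in: "\<lfloor>a\<rfloor> \<in> {- \<lceil>b\<rceil>..\<lceil>b\<rceil>}" if "a \<le> b" "- b \<le> a" for a b :: real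
        using that by (auto; linarith)
      have "g \<omega> \<le> B" "- B \<le> g \<omega>" using B[OF that] by auto
      then have "real (Suc n) * g \<omega> \<le> real (Suc n) * B" "real (Suc n) * (- B) \<le> real (Suc n) * g \<omega>"
        by (intro mult_left_mono; simp)+
      then have "?k \<in> {-?K..?K}" by (intro floor_in) (simp_all only: mult_minus_right)
      moreover have "(\<Sum>k\<in>{-?K..?K}. complex_of_real (real_of_int k / real (Suc n)) * indicator (A n k) \<omega>)
        = (\<Sum>k\<in>{-?K..?K}. if k = ?k then complex_of_real (F n \<omega>) else 0)"
        using that by (intro sum.cong) (auto simp: A_def F_def)
      ultimately show ?thesis by simp
    qed
    ultimately show ?thesis by (rule iffD1[OF has_pvm_integral_cong, rotated])
  qed
  moreover have "cmod (complex_of_real (F n \<omega>) - complex_of_real (g \<omega>)) \<le> inverse (real (Suc n))" for n \<omega>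
  proof -
    have "F n \<omega> - g \<omega> = (real_of_int \<lfloor>real (Suc n) * g \<omega>\<rfloor> - real (Suc n) * g \<omega>) / real (Suc n)"
      by (simp add: F_def diff_divide_distrib)
    also have "\<bar>\<dots>\<bar> \<le> 1 / real (Suc n)"
      unfolding abs_divide by (intro divide_right_mono frac_le) (auto, linarith)
    finally show ?thesis by (simp add: inverse_eq_divide flip: of_real_diff)
  qed
  ultimately show ?thesis
    using g B by (intro pvm_integral_uniform_limit[OF P, of "\<lambda>n \<omega>. complex_of_real (F n \<omega>)" R _ B]) auto
qed

lemma has_pvm_integral_exists:
  fixes P :: "'w set \<Rightarrow> ('a::chilbert_space \<Rightarrow>\<^sub>L 'a)"
  assumes P: "pvm M P" and f: "f \<in> borel_measurable M" and bdd: "bounded (f ` space M)"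
  shows "\<exists>T. has_pvm_integral M P f T"
proof -
  obtain B where B: "\<And>\<omega>. \<omega> \<in> space M \<Longrightarrow> cmod (f \<omega>) \<le> B"
    using bdd by (auto simp: bounded_iff)
  have "\<bar>Re (f \<omega>)\<bar> \<le> B" "\<bar>Im (f \<omega>)\<bar> \<le> B" if "\<omega> \<in> space M" for \<omega>
    using B[OF that] abs_Re_le_cmod abs_Im_le_cmod order_trans by blast+
  then obtain T R where "has_pvm_integral M P (\<lambda>\<omega>. complex_of_real (Re (f \<omega>))) T"
    "has_pvm_integral M P (\<lambda>\<omega>. complex_of_real (Im (f \<omega>))) R"
    using has_pvm_integral_real_exists[OF P, of "\<lambda>\<omega>. Re (f \<omega>)" B]
      has_pvm_integral_real_exists[OF P, of "\<lambda>\<omega>. Im (f \<omega>)" B] f by auto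
  from has_pvm_integral_add[OF this(1) has_pvm_integral_scale[OF this(2), of \<i>]]
  show ?thesis by (auto simp flip: complex_eq)
qed

lemma pvm_integral_eqI: "has_pvm_integral M P f T \<Longrightarrow> pvm_integral M P f = T"
  unfolding pvm_integral_def by (rule the_equality) (auto intro: has_pvm_integral_unique)

section \<open>Projection-valued measures from scalar measures\<close>

text \<open>Call \<open>E\<close> a representative of \<open>A\<close> if \<open>E\<close> is a projection with \<open>\<mu>\<^sub>x(A) = (norm (E x))\<^sup>2\<close> for all
  \<open>x\<close>; there is at most one. The sets that have a representative form a Dynkin system: for
  complements take \<open>1 - E\<close>, and representatives of disjoint sets are orthogonal because
  \<open>\<mu>\<^sub>x(A) + \<mu>\<^sub>x(B) \<le> (norm x)\<^sup>2\<close>, so that their series converges strongly to a projection. Multiplicativity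
  of the resulting set function comes from this orthogonality too, by splitting \<open>A\<close> and \<open>B\<close>
  along \<open>A \<inter> B\<close>.\<close>

lemma pvm_from_measures:
  fixes \<mu> :: "'a::chilbert_space \<Rightarrow> 'w measure" and M :: "'w measure"
  assumes sets: "\<And>x. sets (\<mu> x) = sets M"
    and G: "Int_stable G" "G \<subseteq> Pow (space M)" "sets M = sigma_sets (space M) G"
    and top: "\<And>x. emeasure (\<mu> x) (space M) = ennreal ((norm x)\<^sup>2)"
    and gen: "\<And>A. A \<in> G \<Longrightarrow>
      \<exists>E. projection_op E \<and> (\<forall>x. emeasure (\<mu> x) A = ennreal ((norm (blinfun_apply E x))\<^sup>2))"
  obtains P :: "'w set \<Rightarrow> ('a \<Rightarrow>\<^sub>L 'a)" where "pvm M P"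
    "\<And>A x. A \<in> sets M \<Longrightarrow> emeasure (\<mu> x) A = ennreal ((norm (blinfun_apply (P A) x))\<^sup>2)"
proof -
  define rep where "rep A E \<longleftrightarrow> projection_op E \<and>
      (\<forall>x. emeasure (\<mu> x) A = ennreal ((norm (blinfun_apply E x))\<^sup>2))" for A and E :: "'a \<Rightarrow>\<^sub>L 'a"
  have rep_unique: "E = F" if "rep A E" "rep A F" for A E F
  proof (rule projection_op_eqI)
    fix x
    have "ennreal ((norm (blinfun_apply E x))\<^sup>2) = ennreal ((norm (blinfun_apply F x))\<^sup>2)"
      using that by (metis rep_def)
    then show "norm (blinfun_apply E x) = norm (blinfun_apply F x)" by simp
  qed (use that in \<open>auto simp: rep_def\<close>)
  have space: "space (\<mu> x) = space M" for x using sets sets_eq_imp_space_eq by blast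
  have rep_disjoint: "F o\<^sub>L E = 0"
    if "rep A E" "rep B F" "A \<in> sets M" "B \<in> sets M" "A \<inter> B = {}" for A B E F
  proof (rule orthogonal_projections)
    fix x
    have "ennreal ((norm (blinfun_apply E x))\<^sup>2 + (norm (blinfun_apply F x))\<^sup>2)
        = emeasure (\<mu> x) A + emeasure (\<mu> x) B"
      using that by (simp add: rep_def ennreal_plus)
    also have "\<dots> = emeasure (\<mu> x) (A \<union> B)"
      using that by (intro plus_emeasure) (auto simp: sets)
    also have "\<dots> \<le> ennreal ((norm x)\<^sup>2)"
      unfolding top[symmetric] space[symmetric, of x] by (rule emeasure_space)
    finally show "(norm (blinfun_apply E x))\<^sup>2 + (norm (blinfun_apply F x))\<^sup>2 \<le> (norm x)\<^sup>2"
      by (subst (asm) ennreal_le_iff) simp_all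
  qed (use that in \<open>auto simp: rep_def\<close>)
  have rep_union: "\<exists>F. rep (\<Union>n. A n) F \<and> (\<forall>x. (\<lambda>n. blinfun_apply (E n) x) sums blinfun_apply F x)"
    if A: "disjoint_family A" "range A \<subseteq> sets M" and E: "\<And>n. rep (A n) (E n)"
    for A :: "nat \<Rightarrow> 'w set" and E
  proof -
    have "E n o\<^sub>L E m = 0" if "n \<noteq> m" for n m
      using rep_disjoint[OF E E, of m n] A that by (force simp: disjoint_family_on_def)
    moreover have "projection_op (E n)" for n using E by (simp add: rep_def)
    ultimately obtain F where F: "projection_op F" "\<And>x. (\<lambda>n. blinfun_apply (E n) x) sums blinfun_apply F x"
      "\<And>x. (\<lambda>n. (norm (blinfun_apply (E n) x))\<^sup>2) sums (norm (blinfun_apply F x))\<^sup>2"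
      using orthogonal_projections_sums[of E] by blast
    have "emeasure (\<mu> x) (\<Union>n. A n) = ennreal ((norm (blinfun_apply F x))\<^sup>2)" for x
    proof -
      have "emeasure (\<mu> x) (\<Union>n. A n) = (\<Sum>n. emeasure (\<mu> x) (A n))"
        using A by (intro suminf_emeasure[symmetric]) (auto simp: sets)
      also have "\<dots> = (\<Sum>n. ennreal ((norm (blinfun_apply (E n) x))\<^sup>2))"
        using E by (simp add: rep_def)
      also have "\<dots> = ennreal ((norm (blinfun_apply F x))\<^sup>2)"
        using F(3) by (intro suminf_ennreal_eq) auto
      finally show ?thesis .
    qed
    with F show ?thesis by (auto simp: rep_def)
  qed
  have rep_exists: "\<exists>E. rep A E" if "A \<in> sets M" for A
    using G(1,2) that[unfolded G(3)]
  proof (induction rule: sigma_sets_induct_disjoint)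
    case (basic A)
    then show ?case using gen by (simp add: rep_def)
  next
    case empty
    have "rep {} 0" by (simp add: rep_def projection_op_iff is_adj_zero)
    then show ?case ..
  next
    case (compl A)
    then obtain E where E: "rep A E" by blast
    have "emeasure (\<mu> x) (space M - A) = ennreal ((norm (blinfun_apply (id_blinfun - E) x))\<^sup>2)" for x
    proof -
      have "emeasure (\<mu> x) (space M - A) = emeasure (\<mu> x) (space M) - emeasure (\<mu> x) A"
        using compl E unfolding space[symmetric, of x]
        by (intro emeasure_compl) (auto simp: sets G(3) space rep_def)
      also have "\<dots> = ennreal ((norm x)\<^sup>2 - (norm (blinfun_apply E x))\<^sup>2)"
        using E by (simp add: top rep_def ennreal_minus)
      finally show ?thesis using E by (simp add: rep_def projection_op_Diff(2))
    qed
    with E have "rep (space M - A) (id_blinfun - E)" by (simp add: rep_def projection_op_Diff(1))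
    then show ?case ..
  next
    case (union A)
    then obtain E where "\<And>n. rep (A n) (E n)" by metis
    with rep_union[of A E] union show ?case by (auto simp: G(3))
  qed
  define P where "P A = (SOME E. rep A E)" for A
  have rep_P: "rep A (P A)" if "A \<in> sets M" for A
    unfolding P_def using rep_exists[OF that] by (rule someI_ex)
  have P_empty: "P {} = 0"
    using rep_unique[OF rep_P[of "{}"], of 0] by (simp add: rep_def projection_op_iff is_adj_zero)
  have P_space: "P (space M) = id_blinfun"
    using rep_unique[OF rep_P[of "space M"], of id_blinfun] by (simp add: rep_def projection_op_id top)
  have P_sums: "(\<lambda>n. blinfun_apply (P (A n)) x) sums blinfun_apply (P (\<Union>n. A n)) x"
    if A: "range A \<subseteq> sets M" "disjoint_family A" for A :: "nat \<Rightarrow> 'w set" and x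
  proof -
    have "rep (A n) (P (A n))" for n using A rep_P by blast
    from rep_union[OF A(2,1) this] obtain F where F: "rep (\<Union>n. A n) F"
      "(\<lambda>n. blinfun_apply (P (A n)) x) sums blinfun_apply F x" by blast
    moreover have "rep (\<Union>n. A n) (P (\<Union>n. A n))" using A by (intro rep_P) auto
    ultimately show ?thesis using rep_unique by metis
  qed
  have P_Un: "blinfun_apply (P (A \<union> B)) x = blinfun_apply (P A) x + blinfun_apply (P B) x"
    if "A \<in> sets M" "B \<in> sets M" "A \<inter> B = {}" for A B x
    using P_empty P_sums that by (rule operator_additive_Un)
  have P_disj: "blinfun_apply (P A) (blinfun_apply (P B) x) = 0"
    if "A \<in> sets M" "B \<in> sets M" "A \<inter> B = {}" for A B x
    using rep_disjoint[OF rep_P rep_P, of B A] that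
    by (metis blinfun_apply_blinfun_compose zero_blinfun.rep_eq inf_commute)
  have P_Int: "P (A \<inter> B) = P A o\<^sub>L P B" if "A \<in> sets M" "B \<in> sets M" for A B
  proof (rule blinfun_eqI)
    fix x
    let ?C = "A \<inter> B"
    have C: "?C \<in> sets M" "A - B \<in> sets M" "B - A \<in> sets M" using that by auto
    have split: "blinfun_apply (P A) y = blinfun_apply (P ?C) y + blinfun_apply (P (A - B)) y"
      "blinfun_apply (P B) y = blinfun_apply (P ?C) y + blinfun_apply (P (B - A)) y" for y
      using P_Un[of ?C "A - B" y] P_Un[of ?C "B - A" y] C
      by (simp_all add: Int_Diff_Un Int_commute[of A B] Int_Diff_disjoint)
        (metis Int_Diff_Un Int_Diff_disjoint inf_commute)+
    have "blinfun_apply (P ?C) (blinfun_apply (P ?C) x) = blinfun_apply (P ?C) x"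
      using rep_P[OF C(1)] by (metis rep_def projection_op_iff blinfun_apply_blinfun_compose)
    moreover have "blinfun_apply (P ?C) (blinfun_apply (P (B - A)) x) = 0"
      "blinfun_apply (P (A - B)) (blinfun_apply (P ?C) x) = 0"
      "blinfun_apply (P (A - B)) (blinfun_apply (P (B - A)) x) = 0"
      using C by (auto intro!: P_disj)
    ultimately show "blinfun_apply (P (A \<inter> B)) x = blinfun_apply (P A o\<^sub>L P B) x"
      by (simp add: split blinfun.add_right)
  qed
  show thesis
  proof
    show "pvm M P"
      unfolding pvm_def using rep_P P_empty P_space P_Int P_sums by (auto simp: rep_def)
    show "emeasure (\<mu> x) A = ennreal ((norm (blinfun_apply (P A) x))\<^sup>2)" if "A \<in> sets M" for A x
      using rep_P[OF that] by (simp add: rep_def)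
  qed
qed

section \<open>The projection-valued measure of a Cuntz representation\<close>

locale cuntz_representation =
  fixes N :: nat and S :: "nat \<Rightarrow> ('a::chilbert_space \<Rightarrow>\<^sub>L 'a)"
  assumes N_pos: "N > 0" and cuntz_rep: "cuntz_rep N S"
begin

lemma S_bounded_ops: "i < N \<Longrightarrow> S i \<in> bounded_ops"
  using cuntz_rep by (simp add: cuntz_rep_def)

lemma adj_S_S: "i < N \<Longrightarrow> j < N \<Longrightarrow>
    blinfun_apply (adj (S i)) (blinfun_apply (S j) x) = (if i = j then x else 0)"
  using cuntz_rep unfolding cuntz_rep_def
  by (metis blinfun_apply_blinfun_compose blinfun_apply_id_blinfun id_apply zero_blinfun.rep_eq)

lemma sum_S_adj_S: "(\<Sum>i<N. blinfun_apply (S i) (blinfun_apply (adj (S i)) x)) = x"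
proof -
  have "blinfun_apply (\<Sum>i<N. S i o\<^sub>L adj (S i)) x = x" using cuntz_rep by (simp add: cuntz_rep_def)
  then show ?thesis by (simp add: blinfun.sum_left)
qed

lemma norm_S: "i < N \<Longrightarrow> norm (blinfun_apply (S i) x) = norm x"
proof -
  assume i: "i < N"
  have "cinner (blinfun_apply (S i) x) (blinfun_apply (S i) x) = cinner x x"
    using cinner_adj_right[OF S_bounded_ops[OF i], of x "blinfun_apply (S i) x"]
    by (simp add: adj_S_S i)
  then have "(norm (blinfun_apply (S i) x))\<^sup>2 = (norm x)\<^sup>2"
    unfolding cinner_self of_real_eq_iff .
  then show ?thesis by simp
qed

lemma word_op_bounded_ops: "set I \<subseteq> {..<N} \<Longrightarrow> word_op S I \<in> bounded_ops"
  by (induction I) (auto simp: bounded_ops_intros S_bounded_ops)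

lemma word_op_append: "word_op S (I @ J) = word_op S I o\<^sub>L word_op S J"
  by (induction I) (auto intro!: blinfun_eqI)

lemma adj_word_op_append:
  assumes "set I \<subseteq> {..<N}" "set J \<subseteq> {..<N}"
  shows "adj (word_op S (I @ J)) = adj (word_op S J) o\<^sub>L adj (word_op S I)"
  unfolding word_op_append using assms
  by (intro adj_eqI is_adj_compose is_adj_adj word_op_bounded_ops)

lemma adj_word_op_word_op:
  "set I \<subseteq> {..<N} \<Longrightarrow> blinfun_apply (adj (word_op S I)) (blinfun_apply (word_op S I) x) = x"
proof (induction I arbitrary: x)
  case Nil
  show ?case by (simp add: adj_eqI[OF is_adj_id])
next
  case (Cons i I)
  have "adj (word_op S ([i] @ I)) = adj (word_op S I) o\<^sub>L adj (word_op S [i])"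
    using Cons.prems by (intro adj_word_op_append) auto
  with Cons show ?case by (simp add: compose_id_blinfun adj_S_S)
qed

abbreviation word_projection :: "nat list \<Rightarrow> ('a \<Rightarrow>\<^sub>L 'a)" where
  "word_projection I \<equiv> word_op S I o\<^sub>L adj (word_op S I)"

lemma projection_op_word_projection:
  assumes "set I \<subseteq> {..<N}"
  shows "projection_op (word_projection I)"
  unfolding projection_op_iff
proof
  show "word_projection I o\<^sub>L word_projection I = word_projection I"
    by (rule blinfun_eqI) (simp add: adj_word_op_word_op assms)
  have "is_adj (word_op S I) (adj (word_op S I))"
    using assms by (intro is_adj_adj word_op_bounded_ops)
  then show "is_adj (word_projection I) (word_projection I)"
    by (intro is_adj_compose is_adj_sym[of "word_op S I"])
qed

lemma norm_word_projection:
  assumes "set I \<subseteq> {..<N}"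
  shows "norm (blinfun_apply (word_projection I) x) = norm (blinfun_apply (adj (word_op S I)) x)"
proof -
  have "cinner (blinfun_apply (word_projection I) x) x
      = cinner (blinfun_apply (adj (word_op S I)) x) (blinfun_apply (adj (word_op S I)) x)"
    by (simp add: cinner_adj_right[OF word_op_bounded_ops[OF assms]])
  then have "(norm (blinfun_apply (word_projection I) x))\<^sup>2 = (norm (blinfun_apply (adj (word_op S I)) x))\<^sup>2"
    unfolding cinner_projection[OF projection_op_word_projection[OF assms]] cinner_self of_real_eq_iff .
  then show ?thesis by simp
qed

lemma sum_norm_adj_S: "(\<Sum>j<N. (norm (blinfun_apply (adj (S j)) x))\<^sup>2) = (norm x)\<^sup>2"
proof -
  have "complex_of_real (\<Sum>j<N. (norm (blinfun_apply (adj (S j)) x))\<^sup>2)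
      = cinner (\<Sum>j<N. blinfun_apply (S j) (blinfun_apply (adj (S j)) x)) x"
    by (simp add: cinner_sum_left cinner_adj_right[OF S_bounded_ops, symmetric]
        cinner_self[symmetric] flip: of_real_power)
  also have "\<dots> = complex_of_real ((norm x)\<^sup>2)" by (simp add: sum_S_adj_S cinner_self)
  finally show ?thesis unfolding of_real_eq_iff .
qed

text \<open>For a fixed vector \<open>x\<close> the weights \<open>I \<mapsto> (norm (S\<^sub>I\<^sup>* x))\<^sup>2\<close> are consistent, because
  \<open>\<Sum>\<^sub>j (norm (S\<^sub>j\<^sup>* y))\<^sup>2 = (norm y)\<^sup>2\<close> holds for \<open>y = S\<^sub>I\<^sup>* x\<close>. The resulting measures on \<open>K\<close> are represented by the projections \<open>S\<^sub>IS\<^sub>I\<^sup>*\<close> on cylinders.\<close>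

theorem pvm_exists: "\<exists>P. pvm (word_borel N) P \<and> extends_cylinders N S P"
proof -
  have "\<exists>\<mu>. sets \<mu> = sets (word_borel N) \<and> (\<forall>I. set I \<subseteq> {..<N} \<longrightarrow>
      emeasure \<mu> (cylinder N I) = ennreal ((norm (blinfun_apply (adj (word_op S I)) x))\<^sup>2))" for x
  proof (rule measure_from_weights[OF N_pos])
    fix I assume I: "set I \<subseteq> {..<N}"
    have "adj (word_op S (I @ [j])) = adj (S j) o\<^sub>L adj (word_op S I)" if "j < N" for j
      using adj_word_op_append[OF I, of "[j]"] that by (simp add: compose_id_blinfun)
    then show "(\<Sum>j<N. (norm (blinfun_apply (adj (word_op S (I @ [j]))) x))\<^sup>2)
        = (norm (blinfun_apply (adj (word_op S I)) x))\<^sup>2"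
      by (simp add: sum_norm_adj_S)
  qed simp
  then obtain \<mu> where sets: "\<And>x. sets (\<mu> x) = sets (word_borel N)"
    and cyl: "\<And>x I. set I \<subseteq> {..<N} \<Longrightarrow>
      emeasure (\<mu> x) (cylinder N I) = ennreal ((norm (blinfun_apply (word_projection I) x))\<^sup>2)"
    unfolding norm_word_projection by (metis norm_word_projection)
  obtain P :: "(nat \<Rightarrow> nat) set \<Rightarrow> ('a \<Rightarrow>\<^sub>L 'a)" where P: "pvm (word_borel N) P"
    and em: "\<And>A x. A \<in> sets (word_borel N) \<Longrightarrow>
      emeasure (\<mu> x) A = ennreal ((norm (blinfun_apply (P A) x))\<^sup>2)"
  proof (rule pvm_from_measures[of \<mu> "word_borel N" "range (cylinder N)"])
    show "Int_stable (range (cylinder N))" by (rule Int_stable_cylinders)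
    show "range (cylinder N) \<subseteq> Pow (space (word_borel N))" using cylinder_subset by auto
    show "emeasure (\<mu> x) (space (word_borel N)) = ennreal ((norm x)\<^sup>2)" for x
      using cyl[of "[]" x] by (simp add: adj_eqI[OF is_adj_id])
    fix A assume "A \<in> range (cylinder N)"
    then obtain I where A: "A = cylinder N I" by blast
    show "\<exists>E. projection_op E \<and> (\<forall>x. emeasure (\<mu> x) A = ennreal ((norm (blinfun_apply E x))\<^sup>2))"
    proof (cases "set I \<subseteq> {..<N}")
      case True
      then show ?thesis using cyl projection_op_word_projection A by blast
    next
      case False
      then show ?thesis using A
        by (intro exI[of _ 0]) (simp add: cylinder_invalid projection_op_iff is_adj_zero)
    qed
  qed (auto simp: sets sets_word_borel)
  have "P (cylinder N I) = word_projection I" if "set I \<subseteq> {..<N}" for I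
  proof (rule projection_op_eqI)
    fix x
    have "ennreal ((norm (blinfun_apply (P (cylinder N I)) x))\<^sup>2)
        = ennreal ((norm (blinfun_apply (word_projection I) x))\<^sup>2)"
      using cyl[OF that, of x] em[of "cylinder N I" x] by simp
    then show "norm (blinfun_apply (P (cylinder N I)) x) = norm (blinfun_apply (word_projection I) x)"
      by simp
  qed (use that P in \<open>auto intro: pvm_projection projection_op_word_projection\<close>)
  then have "extends_cylinders N S P" by (simp add: extends_cylinders_def fin_words_def)
  with P show ?thesis by blast
qed

end

section \<open>The canonical endomorphism\<close>

context cuntz_representation
begin

lemma endo_apply:
  "blinfun_apply (cuntz_endo N S T) x = (\<Sum>i<N. blinfun_apply (S i) (blinfun_apply T (blinfun_apply (adj (S i)) x)))"
  by (simp add: cuntz_endo_def blinfun.sum_left)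

lemma adj_S_endo:
  assumes "j < N"
  shows "blinfun_apply (adj (S j)) (blinfun_apply (cuntz_endo N S T) x)
    = blinfun_apply T (blinfun_apply (adj (S j)) x)"
  using assms by (simp add: endo_apply blinfun.sum_right adj_S_S)

lemma endo_bounded_ops: "T \<in> bounded_ops \<Longrightarrow> cuntz_endo N S T \<in> bounded_ops"
  unfolding cuntz_endo_def by (auto intro!: bounded_ops_intros S_bounded_ops adj_bounded_ops)

lemma is_adj_endo: "T \<in> bounded_ops \<Longrightarrow> is_adj (cuntz_endo N S T) (cuntz_endo N S (adj T))"
proof -
  assume T: "T \<in> bounded_ops"
  have "is_adj (S i o\<^sub>L T o\<^sub>L adj (S i)) (S i o\<^sub>L adj T o\<^sub>L adj (S i))" if "i < N" for i
    using cinner_adj[OF T] cinner_adj[OF S_bounded_ops[OF that]]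
    by (simp add: is_adj_def) (metis cinner_adj_right[OF S_bounded_ops[OF that]])
  then show ?thesis unfolding cuntz_endo_def by (intro is_adj_sum) simp
qed

text \<open>Multiplicativity is the intertwining relation \<open>S\<^sub>j\<^sup>* \<alpha>(T) = T S\<^sub>j\<^sup>*\<close>, a consequence of the
  orthogonality of the isometries.\<close>

theorem endomorphism_cuntz_endo: "endomorphism_ops (cuntz_endo N S)"
  unfolding endomorphism_ops_def
proof (intro conjI ballI allI)
  fix T R :: "'a \<Rightarrow>\<^sub>L 'a" and c assume T: "T \<in> bounded_ops"
  show "cuntz_endo N S T \<in> bounded_ops" using T by (rule endo_bounded_ops)
  show "cuntz_endo N S (scale_op c T) = scale_op c (cuntz_endo N S T)"
    by (rule blinfun_eqI) (simp add: endo_apply scale_op.rep_eq scaleC_sum_right bounded_opsD[OF S_bounded_ops])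
  show "cuntz_endo N S (adj T) = adj (cuntz_endo N S T)"
    using is_adj_endo[OF T] by (rule adj_eqI[symmetric])
next
  fix T R :: "'a \<Rightarrow>\<^sub>L 'a"
  show "cuntz_endo N S (T + R) = cuntz_endo N S T + cuntz_endo N S R"
    by (rule blinfun_eqI) (simp add: endo_apply blinfun.add_left blinfun.add_right sum.distrib)
  show "cuntz_endo N S (T o\<^sub>L R) = cuntz_endo N S T o\<^sub>L cuntz_endo N S R"
    by (rule blinfun_eqI) (simp add: endo_apply[of T "blinfun_apply (cuntz_endo N S R) _"]
        endo_apply[of "T o\<^sub>L R"] adj_S_endo)
  show "cuntz_endo N S id_blinfun = id_blinfun"
    by (rule blinfun_eqI) (simp add: endo_apply sum_S_adj_S)
qed

end

section \<open>Covariance under the branches and the shift\<close>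

locale cuntz_pvm = cuntz_representation +
  fixes P :: "(nat \<Rightarrow> nat) set \<Rightarrow> ('a \<Rightarrow>\<^sub>L 'a)"
  assumes pvm: "pvm (word_borel N) P" and extends: "extends_cylinders N S P"
begin

lemma P_cylinder: "set I \<subseteq> {..<N} \<Longrightarrow> P (cylinder N I) = word_projection I"
  using extends by (simp add: extends_cylinders_def fin_words_def)

lemma P_letter: "i < N \<Longrightarrow> P (cylinder N [i]) = S i o\<^sub>L adj (S i)"
  using P_cylinder[of "[i]"] by (simp add: compose_id_blinfun)

lemma branch_image_cylinder: "i < N \<Longrightarrow> branch i ` cylinder N I = cylinder N (i # I)"
proof (subst branch_image[OF _ cylinder_subset], assumption, rule Set.set_eqI)
  fix \<omega>
  show "\<omega> \<in> cylinder N [i] \<inter> (shift -` cylinder N I \<inter> inf_words N) \<longleftrightarrow> \<omega> \<in> cylinder N (i # I)"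
    using subsetD[OF cylinder_subset, of \<omega> N "i # I"] subsetD[OF cylinder_subset, of "shift \<omega>" N I]
    unfolding in_cylinder_Cons Int_iff vimage_eq cylinder_Nil by blast
qed

text \<open>On a cylinder both sides are \<open>S\<^sub>iS\<^sub>IS\<^sub>I\<^sup>*S\<^sub>i\<^sup>*\<close>. Complements are taken inside \<open>C(i)\<close>, the
  image of the whole space under \<open>\<sigma>\<^sub>i\<close>, where both sides have the same total \<open>S\<^sub>iS\<^sub>i\<^sup>*\<close>.\<close>

theorem covariance:
  assumes i: "i < N" and A: "A \<in> sets (word_borel N)"
  shows "S i o\<^sub>L P A o\<^sub>L adj (S i) = P (branch i ` A)"
  using A
proof (induction rule: word_borel_induct_disjoint)
  case (cylinder I)
  have "adj (word_op S (i # I)) = adj (word_op S I) o\<^sub>L adj (S i)"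
    using adj_word_op_append[of "[i]" I] cylinder i by (simp add: compose_id_blinfun)
  with cylinder i show ?case
    by (intro blinfun_eqI) (simp add: branch_image_cylinder P_cylinder)
next
  case (compl A)
  have sub: "branch i ` A \<subseteq> cylinder N [i]"
    using branch_image[OF i sets_word_borel_subset[OF compl(1)]] by blast
  have eq: "branch i ` (inf_words N - A) = cylinder N [i] - branch i ` A"
    using branch_image_cylinder[OF i, of "[]"] by (simp add: image_set_diff inj_branch)
  have "P (branch i ` A \<union> (cylinder N [i] - branch i ` A)) = P (branch i ` A) + P (cylinder N [i] - branch i ` A)"
    using branch_image_sets[OF i compl(1)] by (intro pvm_Un[OF pvm]) auto
  also have "branch i ` A \<union> (cylinder N [i] - branch i ` A) = cylinder N [i]" using sub by blast
  finally have "P (branch i ` (inf_words N - A)) = (S i o\<^sub>L adj (S i)) - (S i o\<^sub>L P A o\<^sub>L adj (S i))"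
    unfolding eq compl(2) by (simp add: P_letter i eq_diff_eq add.commute)
  moreover have "P (inf_words N - A) = id_blinfun - P A" using pvm_Diff[OF pvm compl(1)] by simp
  ultimately show ?case by (intro blinfun_eqI) (simp add: blinfun.diff_left blinfun.diff_right)
next
  case (union A)
  show ?case
  proof (rule blinfun_eqI)
    fix x
    have "(\<lambda>n. blinfun_apply (P (A n)) (blinfun_apply (adj (S i)) x)) sums
        blinfun_apply (P (\<Union>n. A n)) (blinfun_apply (adj (S i)) x)"
      using union by (intro pvm_sums[OF pvm])
    from bounded_linear.sums[OF blinfun.bounded_linear_right this, of "S i"]
    have "(\<lambda>n. blinfun_apply (P (branch i ` A n)) x) sums
        blinfun_apply (S i o\<^sub>L P (\<Union>n. A n) o\<^sub>L adj (S i)) x"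
      by (simp flip: union(3))
    moreover have "(\<lambda>n. blinfun_apply (P (branch i ` A n)) x) sums blinfun_apply (P (\<Union>n. branch i ` A n)) x"
    proof (rule pvm_sums[OF pvm])
      show "range (\<lambda>n. branch i ` A n) \<subseteq> sets (word_borel N)"
        using union(2) branch_image_sets[OF i] by auto
      show "disjoint_family (\<lambda>n. branch i ` A n)"
        using union(1) by (simp add: disjoint_family_on_def flip: image_Int[OF inj_branch])
    qed
    ultimately show "blinfun_apply (S i o\<^sub>L P (\<Union>n. A n) o\<^sub>L adj (S i)) x = blinfun_apply (P (branch i ` (\<Union>n. A n))) x"
      unfolding image_UN by (rule sums_unique2)
  qed
next
  case empty
  show ?case by (rule blinfun_eqI) (simp add: pvm_empty[OF pvm])
qed

text \<open>The images of the branches lie in the disjoint sets \<open>C(j)\<close>. Both sum formulas are instances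
  of this: one with \<open>A\<^sub>j = A\<close>, the other with \<open>A\<^sub>j = \<sigma>\<^sub>j\<^sup>-\<^sup>1(A)\<close>.\<close>

lemma sum_P_branch_images:
  assumes A: "\<And>j. j < N \<Longrightarrow> A j \<in> sets (word_borel N)"
  shows "(\<Sum>j<N. S j o\<^sub>L P (A j) o\<^sub>L adj (S j)) = P (\<Union>j<N. branch j ` A j)"
proof -
  have "branch j ` A j \<subseteq> cylinder N [j]" if "j < N" for j
    using branch_image[OF that sets_word_borel_subset[OF A[OF that]]] by blast
  then have "disjoint_family_on (\<lambda>j. branch j ` A j) {..<N}"
    by (fastforce simp: disjoint_family_on_def in_cylinder_Cons)
  then have "P (\<Union>j<N. branch j ` A j) = (\<Sum>j<N. P (branch j ` A j))"
    using A by (intro pvm_finite_UN[OF pvm]) (auto intro: branch_image_sets)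
  with A show ?thesis by (simp add: covariance)
qed

theorem sum_branch_preimages:
  assumes "A \<in> sets (word_borel N)"
  shows "(\<Sum>j<N. S j o\<^sub>L P (branch j -` A \<inter> inf_words N) o\<^sub>L adj (S j)) = P A"
proof -
  have "(\<Union>j<N. branch j ` (branch j -` A \<inter> inf_words N)) = A"
  proof
    show "A \<subseteq> (\<Union>j<N. branch j ` (branch j -` A \<inter> inf_words N))"
    proof
      fix \<omega> assume "\<omega> \<in> A"
      then have "\<omega> \<in> inf_words N" using sets_word_borel_subset[OF assms] by blast
      then have "\<omega> 0 < N" "shift \<omega> \<in> inf_words N" by (auto simp: inf_words_iff shift_def)
      moreover have "\<omega> = branch (\<omega> 0) (shift \<omega>)" by (simp add: branch_shift)
      ultimately show "\<omega> \<in> (\<Union>j<N. branch j ` (branch j -` A \<inter> inf_words N))"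
        using \<open>\<omega> \<in> A\<close> by (metis (no_types, lifting) IntI UN_I imageI lessThan_iff vimageI)
    qed
  qed auto
  moreover have "branch j -` A \<inter> inf_words N \<in> sets (word_borel N)" if "j < N" for j
    using measurable_sets[OF measurable_branch[OF that] assms] by simp
  ultimately show ?thesis using sum_P_branch_images[of "\<lambda>j. branch j -` A \<inter> inf_words N"] by simp
qed

theorem endo_P:
  assumes "A \<in> sets (word_borel N)"
  shows "cuntz_endo N S (P A) = P (shift -` A \<inter> inf_words N)"
proof -
  have "(\<Union>j<N. branch j ` A) = shift -` A \<inter> inf_words N"
    using branch_image[OF _ sets_word_borel_subset[OF assms]]
    by (auto simp: in_cylinder_Cons inf_words_iff shift_inf_words) (auto simp: shift_def)
  with sum_P_branch_images[of "\<lambda>_. A"] assms show ?thesis by (simp add: cuntz_endo_def)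
qed

text \<open>Covariance in terms of scalar measures: since \<open>S\<^sub>i\<close> is an isometry, pushing the measure of
  \<open>S\<^sub>i\<^sup>* x\<close> forward along \<open>\<sigma>\<^sub>i\<close> gives the part of the measure of \<open>x\<close> that lives on \<open>C(i)\<close>.\<close>

lemma distr_branch_pvm_measure:
  assumes i: "i < N"
  shows "distr (pvm_measure (word_borel N) P (blinfun_apply (adj (S i)) x)) (word_borel N) (branch i)
    = density (pvm_measure (word_borel N) P x) (indicator (cylinder N [i]))"
proof (rule measure_eqI)
  fix A assume "A \<in> sets (distr (pvm_measure (word_borel N) P (blinfun_apply (adj (S i)) x)) (word_borel N) (branch i))"
  then have A: "A \<in> sets (word_borel N)" by simp
  let ?B = "branch i -` A \<inter> inf_words N"
  have B: "?B \<in> sets (word_borel N)"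
    using measurable_sets[OF measurable_branch[OF i] A] by simp
  have "branch i ` ?B = cylinder N [i] \<inter> A"
    using sets_word_borel_subset[OF A] branch_shift
    by (subst branch_image[OF i]) (auto simp: in_cylinder_Cons shift_inf_words)
  with covariance[OF i B] have "P (cylinder N [i] \<inter> A) = S i o\<^sub>L P ?B o\<^sub>L adj (S i)" by simp
  then have "norm (blinfun_apply (P (cylinder N [i] \<inter> A)) x) = norm (blinfun_apply (P ?B) (blinfun_apply (adj (S i)) x))"
    by (simp add: norm_S i)
  then show "emeasure (distr (pvm_measure (word_borel N) P (blinfun_apply (adj (S i)) x)) (word_borel N) (branch i)) A
    = emeasure (density (pvm_measure (word_borel N) P x) (indicator (cylinder N [i]))) A"
    using A B measurable_branch[OF i]
    by (simp add: emeasure_restricted emeasure_distr emeasure_pvm_measure[OF pvm] measurable_def sets.Int)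
qed simp

text \<open>The quadratic form of \<open>\<alpha>(T)\<close> at \<open>x\<close> is the sum of the forms of \<open>T\<close> at the vectors \<open>S\<^sub>i\<^sup>* x\<close>.
  Because \<open>\<sigma> \<circ> \<sigma>\<^sub>i\<close> is the identity, the \<open>i\<close>-th summand is the integral of \<open>f \<circ> \<sigma>\<close> over
  \<open>C(i)\<close> with respect to the measure of \<open>x\<close>.\<close>

theorem has_pvm_integral_shift:
  assumes T: "has_pvm_integral (word_borel N) P f T"
  shows "has_pvm_integral (word_borel N) P (\<lambda>\<omega>. f (shift \<omega>)) (cuntz_endo N S T)"
  unfolding has_pvm_integral_def
proof (intro conjI allI)
  show "cuntz_endo N S T \<in> bounded_ops"
    using T by (intro endo_bounded_ops) (simp add: has_pvm_integral_def)
  fix x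
  define \<mu> where "\<mu> = pvm_measure (word_borel N) P x"
  define \<nu> where "\<nu> i = pvm_measure (word_borel N) P (blinfun_apply (adj (S i)) x)" for i
  have sets: "sets \<mu> = sets (word_borel N)" "sets (\<nu> i) = sets (word_borel N)" for i
    by (simp_all add: \<mu>_def \<nu>_def)
  have int: "integrable (\<nu> i) f" for i
    using T by (simp add: has_pvm_integral_def \<nu>_def)
  have f: "f \<in> borel_measurable (word_borel N)"
    using borel_measurable_integrable[OF int[of 0]] sets(2) measurable_cong_sets by blast
  have fs: "(\<lambda>\<omega>. f (shift \<omega>)) \<in> borel_measurable (word_borel N)"
    using measurable_compose[OF measurable_shift f] .
  have piece: "integrable \<mu> (\<lambda>\<omega>. indicator (cylinder N [i]) \<omega> *\<^sub>R f (shift \<omega>)) \<and>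
      (\<integral>\<omega>. indicator (cylinder N [i]) \<omega> *\<^sub>R f (shift \<omega>) \<partial>\<mu>) = (\<integral>\<omega>. f \<omega> \<partial>\<nu> i)" if i: "i < N" for i
  proof -
    have br: "branch i \<in> measurable (\<nu> i) (word_borel N)"
      using measurable_branch[OF i] sets(2) measurable_cong_sets by blast
    have eq: "distr (\<nu> i) (word_borel N) (branch i) = density \<mu> (\<lambda>\<omega>. ennreal (indicator (cylinder N [i]) \<omega>))"
      unfolding \<mu>_def \<nu>_def ennreal_indicator by (rule distr_branch_pvm_measure[OF i])
    have fs': "(\<lambda>\<omega>. f (shift \<omega>)) \<in> borel_measurable \<mu>"
      using fs sets(1) measurable_cong_sets by blast
    have ind: "(indicator (cylinder N [i]) :: _ \<Rightarrow> real) \<in> borel_measurable \<mu>"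
      by (simp add: sets borel_measurable_indicator)
    have "integrable (distr (\<nu> i) (word_borel N) (branch i)) (\<lambda>\<omega>. f (shift \<omega>))"
      using int[of i] by (subst integrable_distr_eq[OF br fs]) simp
    then have 1: "integrable \<mu> (\<lambda>\<omega>. indicator (cylinder N [i]) \<omega> *\<^sub>R f (shift \<omega>))"
      unfolding eq by (subst (asm) integrable_density[OF fs' ind]) auto
    have "(\<integral>\<omega>. f \<omega> \<partial>\<nu> i) = (\<integral>\<omega>. f (shift \<omega>) \<partial>distr (\<nu> i) (word_borel N) (branch i))"
      by (subst integral_distr[OF br fs]) simp
    also have "\<dots> = (\<integral>\<omega>. indicator (cylinder N [i]) \<omega> *\<^sub>R f (shift \<omega>) \<partial>\<mu>)"
      unfolding eq by (subst integral_density[OF fs' ind]) auto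
    finally show ?thesis using 1 by simp
  qed
  have split: "f (shift \<omega>) = (\<Sum>i<N. indicator (cylinder N [i]) \<omega> *\<^sub>R f (shift \<omega>))" if "\<omega> \<in> inf_words N" for \<omega>
  proof -
    have "indicator (cylinder N [i]) \<omega> *\<^sub>R f (shift \<omega>) = (if i = \<omega> 0 then f (shift \<omega>) else 0)" if "i < N" for i
      using that \<open>\<omega> \<in> inf_words N\<close> by (simp add: indicator_def in_cylinder_Cons shift_inf_words)
    then show ?thesis using that by (simp add: inf_words_iff)
  qed
  have "integrable \<mu> (\<lambda>\<omega>. \<Sum>i<N. indicator (cylinder N [i]) \<omega> *\<^sub>R f (shift \<omega>))"
    using piece by (intro Bochner_Integration.integrable_sum) auto
  moreover have "integrable \<mu> (\<lambda>\<omega>. f (shift \<omega>))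
      = integrable \<mu> (\<lambda>\<omega>. \<Sum>i<N. indicator (cylinder N [i]) \<omega> *\<^sub>R f (shift \<omega>))"
    by (intro Bochner_Integration.integrable_cong refl split) (simp add: \<mu>_def)
  ultimately show "integrable (pvm_measure (word_borel N) P x) (\<lambda>\<omega>. f (shift \<omega>))"
    by (simp add: \<mu>_def)
  have "cinner (blinfun_apply (cuntz_endo N S T) x) x
      = (\<Sum>i<N. cinner (blinfun_apply T (blinfun_apply (adj (S i)) x)) (blinfun_apply (adj (S i)) x))"
    by (simp add: endo_apply cinner_sum_left cinner_adj_right[OF S_bounded_ops])
  also have "\<dots> = (\<Sum>i<N. \<integral>\<omega>. f \<omega> \<partial>\<nu> i)"
    using T by (simp add: has_pvm_integral_def \<nu>_def)
  also have "\<dots> = (\<Sum>i<N. \<integral>\<omega>. indicator (cylinder N [i]) \<omega> *\<^sub>R f (shift \<omega>) \<partial>\<mu>)"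
    using piece by simp
  also have "\<dots> = (\<integral>\<omega>. (\<Sum>i<N. indicator (cylinder N [i]) \<omega> *\<^sub>R f (shift \<omega>)) \<partial>\<mu>)"
    using piece by (intro Bochner_Integration.integral_sum[symmetric]) auto
  also have "\<dots> = (\<integral>\<omega>. f (shift \<omega>) \<partial>\<mu>)"
    by (intro Bochner_Integration.integral_cong refl split[symmetric]) (simp add: \<mu>_def)
  finally show "cinner (blinfun_apply (cuntz_endo N S T) x) x = (\<integral>\<omega>. f (shift \<omega>) \<partial>pvm_measure (word_borel N) P x)"
    by (simp add: \<mu>_def)
qed

end

section \<open>The unitary representation of the dual group\<close>

text \<open>One factor of the pairing. Only finitely many factors differ from \<open>1\<close>, so that the infinite
  product is a finite one.\<close>

definition duality_factor :: "nat \<Rightarrow> nat \<Rightarrow> nat \<Rightarrow> complex" where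
  "duality_factor N a b = exp (2 * complex_of_real pi * \<i> * of_nat a * of_nat b / of_nat N)"

lemma pairing_eq_prod:
  assumes "vanishes_from \<xi> n"
  shows "pairing N \<omega> \<xi> = (\<Prod>k<n. duality_factor N (\<omega> k) (\<xi> k))"
  unfolding pairing_def duality_factor_def
  using assms by (intro prodinf_finite) (auto simp: vanishes_from_def not_less)

lemma duality_factor_add:
  assumes "N > 0"
  shows "duality_factor N a ((b + c) mod N) = duality_factor N a b * duality_factor N a c"
proof -
  define q where "q = (b + c) div N"
  have r: "of_nat ((b + c) mod N) = (of_nat b + of_nat c - of_nat N * of_nat q :: complex)"
    using mult_div_mod_eq[of N "b + c"] unfolding q_def
    by (metis add_diff_cancel_left' of_nat_add of_nat_mult)
  have "2 * complex_of_real pi * \<i> * of_nat a * of_nat ((b + c) mod N) / of_nat N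
      = 2 * complex_of_real pi * \<i> * of_nat a * of_nat b / of_nat N
        + 2 * complex_of_real pi * \<i> * of_nat a * of_nat c / of_nat N
        - 2 * complex_of_real pi * \<i> * of_nat (a * q)"
    unfolding r using assms by (simp add: field_simps)
  moreover have "exp (2 * complex_of_real pi * \<i> * of_nat (a * q)) = 1"
    using exp_integer_2pi[of "of_nat (a * q)"] by (simp add: mult_ac)
  ultimately show ?thesis unfolding duality_factor_def by (simp add: exp_add exp_diff)
qed

lemma norm_duality_factor: "cmod (duality_factor N a b) = 1"
proof -
  have "2 * complex_of_real pi * \<i> * of_nat a * of_nat b / of_nat N
      = \<i> * complex_of_real (2 * pi * real a * real b / real N)" by simp
  then show ?thesis unfolding duality_factor_def by (metis norm_exp_i_times)
qed

lemma norm_pairing: "vanishes_from \<xi> n \<Longrightarrow> cmod (pairing N \<omega> \<xi>) = 1"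
  by (simp add: pairing_eq_prod prod_norm[symmetric] norm_duality_factor)

lemma vanishes_from_mono: "vanishes_from \<xi> n \<Longrightarrow> n \<le> m \<Longrightarrow> vanishes_from \<xi> m"
  by (simp add: vanishes_from_def)

lemma vanishes_from_mult:
  "vanishes_from \<xi> n \<Longrightarrow> vanishes_from \<eta> n \<Longrightarrow> vanishes_from (\<xi> \<otimes>\<^bsub>dual_group N\<^esub> \<eta>) n"
  by (simp add: vanishes_from_def dual_group_def)

lemma pairing_mult:
  assumes "N > 0" "vanishes_from \<xi> n" "vanishes_from \<eta> n"
  shows "pairing N \<omega> (\<xi> \<otimes>\<^bsub>dual_group N\<^esub> \<eta>) = pairing N \<omega> \<xi> * pairing N \<omega> \<eta>"
  unfolding pairing_eq_prod[OF assms(2)] pairing_eq_prod[OF assms(3)]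
    pairing_eq_prod[OF vanishes_from_mult[OF assms(2,3)]] prod.distrib[symmetric]
  using assms(1) by (simp add: dual_group_def duality_factor_add)

lemma vanishes_from_dual_shift: "vanishes_from \<xi> n \<Longrightarrow> vanishes_from (dual_shift \<xi>) (Suc n)"
  by (auto simp: vanishes_from_def dual_shift_def split: nat.split)

lemma pairing_dual_shift:
  assumes "vanishes_from \<xi> n"
  shows "pairing N \<omega> (dual_shift \<xi>) = pairing N (shift \<omega>) \<xi>"
  unfolding pairing_eq_prod[OF assms] pairing_eq_prod[OF vanishes_from_dual_shift[OF assms]]
  unfolding lessThan_Suc_eq_insert_0
  by (simp add: prod.reindex dual_shift_def shift_def duality_factor_def)

context cuntz_pvm
begin

lemma disjoint_cylinders: "disjoint_family_on (cylinder N) (fin_words N n)"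
  unfolding disjoint_family_on_def
  by (auto simp: cylinder_def fin_words_def intro!: nth_equalityI)

lemma UN_cylinders: "(\<Union>I\<in>fin_words N n. cylinder N I) = inf_words N"
proof
  show "inf_words N \<subseteq> (\<Union>I\<in>fin_words N n. cylinder N I)"
  proof
    fix \<omega> assume "\<omega> \<in> inf_words N"
    then have "map \<omega> [0..<n] \<in> fin_words N n" "\<omega> \<in> cylinder N (map \<omega> [0..<n])"
      by (auto simp: fin_words_def cylinder_def inf_words_iff)
    then show "\<omega> \<in> (\<Union>I\<in>fin_words N n. cylinder N I)" by blast
  qed
qed (use cylinder_subset in blast)

text \<open>The algebra of operators that are diagonal with respect to the decomposition of the space by
  words of length \<open>n\<close>. Its operations are those of the coefficient functions, which
  yields unitarity and multiplicativity of \<open>U\<close>.\<close>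

definition word_diagonal :: "nat \<Rightarrow> (nat list \<Rightarrow> complex) \<Rightarrow> ('a \<Rightarrow>\<^sub>L 'a)" where
  "word_diagonal n c = (\<Sum>I\<in>fin_words N n. scale_op (c I) (P (cylinder N I)))"

lemma dual_rep_sum_eq_word_diagonal:
  "dual_rep_sum N S n \<xi> = word_diagonal n (\<lambda>I. pairing N (pad I) \<xi>)"
  unfolding dual_rep_sum_def word_diagonal_def
  by (intro sum.cong refl) (simp add: P_cylinder fin_words_def)

lemma word_diagonal_one: "word_diagonal n (\<lambda>_. 1) = id_blinfun"
proof -
  have "word_diagonal n (\<lambda>_. 1) = (\<Sum>I\<in>fin_words N n. P (cylinder N I))"
    unfolding word_diagonal_def by (intro sum.cong refl blinfun_eqI) (simp add: scale_op.rep_eq)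
  also have "\<dots> = P (\<Union>I\<in>fin_words N n. cylinder N I)"
    by (rule pvm_finite_UN[OF pvm finite_fin_words _ disjoint_cylinders, symmetric]) simp
  also have "\<dots> = id_blinfun" using pvm_space[OF pvm] by (simp add: UN_cylinders)
  finally show ?thesis .
qed

lemma word_diagonal_mult: "word_diagonal n c o\<^sub>L word_diagonal n d = word_diagonal n (\<lambda>I. c I * d I)"
proof (rule blinfun_eqI)
  fix x
  have PP: "blinfun_apply (P (cylinder N I)) (blinfun_apply (P (cylinder N J)) x)
      = (if I = J then blinfun_apply (P (cylinder N I)) x else 0)"
    if "I \<in> fin_words N n" "J \<in> fin_words N n" for I J
  proof -
    have "P (cylinder N I) o\<^sub>L P (cylinder N J) = P (cylinder N I \<inter> cylinder N J)"
      by (rule pvm_Int[OF pvm, symmetric]) simp_all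
    moreover have "cylinder N I \<inter> cylinder N J = (if I = J then cylinder N I else {})"
      using disjoint_cylinders that unfolding disjoint_family_on_def by auto
    ultimately show ?thesis
      using blinfun_apply_blinfun_compose[of "P (cylinder N I)" "P (cylinder N J)" x]
      by (auto simp: pvm_empty[OF pvm])
  qed
  have "blinfun_apply (word_diagonal n c o\<^sub>L word_diagonal n d) x
      = (\<Sum>J\<in>fin_words N n. \<Sum>I\<in>fin_words N n.
           c I *\<^sub>C d J *\<^sub>C (if I = J then blinfun_apply (P (cylinder N I)) x else 0))"
    by (simp add: word_diagonal_def blinfun.sum_left blinfun.sum_right scale_op.rep_eq scaleC_sum_right
        bounded_opsD[OF pvm_bounded_ops[OF pvm cylinder_sets]] PP)
  also have "\<dots> = (\<Sum>I\<in>fin_words N n. \<Sum>J\<in>fin_words N n.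
           c I *\<^sub>C d J *\<^sub>C (if I = J then blinfun_apply (P (cylinder N I)) x else 0))"
    by (rule sum.swap)
  also have "\<dots> = (\<Sum>I\<in>fin_words N n. (c I * d I) *\<^sub>C blinfun_apply (P (cylinder N I)) x)"
  proof (intro sum.cong refl)
    fix I assume "I \<in> fin_words N n"
    then have "(\<Sum>J\<in>fin_words N n. c I *\<^sub>C d J *\<^sub>C (if I = J then blinfun_apply (P (cylinder N I)) x else 0))
      = (\<Sum>J\<in>fin_words N n. if I = J then (c I * d I) *\<^sub>C blinfun_apply (P (cylinder N I)) x else 0)"
      by (intro sum.cong) (auto simp: scaleC_scaleC)
    also have "\<dots> = (c I * d I) *\<^sub>C blinfun_apply (P (cylinder N I)) x"
      using \<open>I \<in> fin_words N n\<close> by (simp add: finite_fin_words)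
    finally show "(\<Sum>J\<in>fin_words N n. c I *\<^sub>C d J *\<^sub>C (if I = J then blinfun_apply (P (cylinder N I)) x else 0))
      = (c I * d I) *\<^sub>C blinfun_apply (P (cylinder N I)) x" .
  qed
  finally show "blinfun_apply (word_diagonal n c o\<^sub>L word_diagonal n d) x
      = blinfun_apply (word_diagonal n (\<lambda>I. c I * d I)) x"
    by (simp add: word_diagonal_def blinfun.sum_left scale_op.rep_eq)
qed

lemma is_adj_word_diagonal: "is_adj (word_diagonal n c) (word_diagonal n (\<lambda>I. cnj (c I)))"
  unfolding word_diagonal_def
  using pvm_projection[OF pvm cylinder_sets] by (intro is_adj_sum is_adj_scale) (simp add: projection_op_iff)

text \<open>As a function of \<open>\<omega>\<close> the character depends on the first \<open>n\<close> letters only, so it is a linear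
  combination of indicators of cylinders. The integral does not involve \<open>n\<close>; this is why the sum is
  the same for every admissible \<open>n\<close>.\<close>

theorem has_pvm_integral_dual_rep_sum:
  assumes "vanishes_from \<xi> n"
  shows "has_pvm_integral (word_borel N) P (\<lambda>\<omega>. pairing N \<omega> \<xi>) (dual_rep_sum N S n \<xi>)"
proof -
  have "has_pvm_integral (word_borel N) P
      (\<lambda>\<omega>. \<Sum>I\<in>fin_words N n. pairing N (pad I) \<xi> * indicator (cylinder N I) \<omega>) (dual_rep_sum N S n \<xi>)"
    unfolding dual_rep_sum_eq_word_diagonal word_diagonal_def
    by (intro has_pvm_integral_sum has_pvm_integral_scale has_pvm_integral_indicator pvm cylinder_sets)
  moreover have "(\<Sum>I\<in>fin_words N n. pairing N (pad I) \<xi> * indicator (cylinder N I) \<omega>) = pairing N \<omega> \<xi>"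
    if "\<omega> \<in> space (word_borel N)" for \<omega>
  proof -
    let ?J = "map \<omega> [0..<n]"
    have \<omega>: "\<omega> \<in> inf_words N" using that by simp
    then have J: "?J \<in> fin_words N n" by (auto simp: fin_words_def inf_words_iff)
    have "\<omega> \<in> cylinder N I \<longleftrightarrow> I = ?J" if "I \<in> fin_words N n" for I
      using that \<omega> by (auto simp: cylinder_def fin_words_def list_eq_iff_nth_eq)
    then have "(\<Sum>I\<in>fin_words N n. pairing N (pad I) \<xi> * indicator (cylinder N I) \<omega>)
        = (\<Sum>I\<in>fin_words N n. if I = ?J then pairing N (pad ?J) \<xi> else 0)"
      by (intro sum.cong) (auto simp: indicator_def)
    also have "\<dots> = pairing N (pad ?J) \<xi>" using J by (simp add: finite_fin_words)
    also have "\<dots> = pairing N \<omega> \<xi>"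
      unfolding pairing_eq_prod[OF assms] by (simp add: pad_def)
    finally show ?thesis .
  qed
  ultimately show ?thesis by (rule iffD1[OF has_pvm_integral_cong, rotated])
qed

lemma dual_group_vanishes:
  assumes "\<xi> \<in> carrier (dual_group N)"
  shows "vanishes_from \<xi> (LEAST n. vanishes_from \<xi> n)"
  using assms unfolding dual_group_def by (auto intro: LeastI_ex)

lemma has_pvm_integral_dual_rep:
  assumes "\<xi> \<in> carrier (dual_group N)"
  shows "has_pvm_integral (word_borel N) P (\<lambda>\<omega>. pairing N \<omega> \<xi>) (dual_rep N S \<xi>)"
  unfolding dual_rep_def by (intro has_pvm_integral_dual_rep_sum dual_group_vanishes assms)

theorem dual_rep_eq_sum:
  assumes "\<xi> \<in> carrier (dual_group N)" "vanishes_from \<xi> n"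
  shows "dual_rep N S \<xi> = dual_rep_sum N S n \<xi>"
  using has_pvm_integral_dual_rep[OF assms(1)] has_pvm_integral_dual_rep_sum[OF assms(2)]
  by (rule has_pvm_integral_unique)

theorem dual_rep_hom: "dual_rep N S \<in> hom (dual_group N) unitary_group"
proof (rule homI)
  fix \<xi> assume \<xi>: "\<xi> \<in> carrier (dual_group N)"
  define n where "n = (LEAST n. vanishes_from \<xi> n)"
  define c where "c I = pairing N (pad I) \<xi>" for I
  have eq: "dual_rep N S \<xi> = word_diagonal n c"
    unfolding dual_rep_def n_def c_def by (rule dual_rep_sum_eq_word_diagonal)
  have adj: "adj (word_diagonal n c) = word_diagonal n (\<lambda>I. cnj (c I))"
    by (rule adj_eqI[OF is_adj_word_diagonal])
  have "cmod (c I) = 1" for I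
    unfolding c_def by (rule norm_pairing[OF dual_group_vanishes[OF \<xi>]])
  then have "c I * cnj (c I) = 1" for I by (simp add: complex_norm_square[symmetric])
  then have "cnj (c I) * c I = 1" "c I * cnj (c I) = 1" for I by (simp_all add: mult.commute)
  moreover have "dual_rep N S \<xi> \<in> bounded_ops"
    using has_pvm_integral_dual_rep[OF \<xi>] by (simp add: has_pvm_integral_def)
  ultimately show "dual_rep N S \<xi> \<in> carrier unitary_group"
    unfolding unitary_group_def eq by (simp add: adj word_diagonal_mult word_diagonal_one)
next
  fix \<xi> \<eta> assume \<xi>: "\<xi> \<in> carrier (dual_group N)" and \<eta>: "\<eta> \<in> carrier (dual_group N)"
  obtain n where v: "vanishes_from \<xi> n" "vanishes_from \<eta> n"
    using vanishes_from_mono[OF dual_group_vanishes[OF \<xi>]] vanishes_from_mono[OF dual_group_vanishes[OF \<eta>]]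
    by (meson max.cobounded1 max.cobounded2)
  interpret comm_group "dual_group N" using N_pos by (rule comm_group_dual_group)
  have "dual_rep N S (\<xi> \<otimes>\<^bsub>dual_group N\<^esub> \<eta>) = dual_rep N S \<xi> o\<^sub>L dual_rep N S \<eta>"
    unfolding dual_rep_eq_sum[OF \<xi> v(1)] dual_rep_eq_sum[OF \<eta> v(2)]
      dual_rep_eq_sum[OF m_closed[OF \<xi> \<eta>] vanishes_from_mult[OF v]]
      dual_rep_sum_eq_word_diagonal word_diagonal_mult pairing_mult[OF N_pos v] ..
  then show "dual_rep N S (\<xi> \<otimes>\<^bsub>dual_group N\<^esub> \<eta>) = dual_rep N S \<xi> \<otimes>\<^bsub>unitary_group\<^esub> dual_rep N S \<eta>"
    by (simp add: unitary_group_def)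
qed

text \<open>The dual shift is adjoint to the shift, \<open>\<langle>\<omega>, dual_shift \<xi>\<rangle> = \<langle>shift \<omega>, \<xi>\<rangle>\<close>, so the claim is the
  integral formula for the endomorphism at a character.\<close>

theorem endo_dual_rep:
  assumes \<xi>: "\<xi> \<in> carrier (dual_group N)"
  shows "cuntz_endo N S (dual_rep N S \<xi>) = dual_rep N S (dual_shift \<xi>)"
proof -
  obtain n where v: "vanishes_from \<xi> n" using dual_group_vanishes[OF \<xi>] by blast
  have "dual_shift \<xi> \<in> carrier (dual_group N)"
    using \<xi> N_pos vanishes_from_dual_shift[OF v]
    by (auto simp: dual_group_def inf_words_iff dual_shift_def split: nat.split)
  from has_pvm_integral_dual_rep[OF this]
  have "has_pvm_integral (word_borel N) P (\<lambda>\<omega>. pairing N (shift \<omega>) \<xi>) (dual_rep N S (dual_shift \<xi>))"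
    by (simp add: pairing_dual_shift[OF v])
  with has_pvm_integral_shift[OF has_pvm_integral_dual_rep[OF \<xi>]] show ?thesis
    by (rule has_pvm_integral_unique)
qed

theorem endo_pvm_integral:
  assumes "f \<in> borel_measurable (word_borel N)" "bounded (f ` inf_words N)"
  shows "cuntz_endo N S (pvm_integral (word_borel N) P f) = pvm_integral (word_borel N) P (\<lambda>\<omega>. f (shift \<omega>))"
proof -
  obtain T where T: "has_pvm_integral (word_borel N) P f T"
    using has_pvm_integral_exists[OF pvm] assms by auto
  show ?thesis
    using pvm_integral_eqI[OF T] pvm_integral_eqI[OF has_pvm_integral_shift[OF T]] by simp
qed

end

theorem theorem2p6:
  fixes N :: nat and S :: "nat \<Rightarrow> ('a::chilbert_space \<Rightarrow>\<^sub>L 'a)"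
  assumes "N \<ge> 2" and "cuntz_rep N S"
  shows
    "(\<exists>P. pvm (word_borel N) P \<and> extends_cylinders N S P) \<and>
     (\<forall>\<xi>\<in>carrier (dual_group N). \<forall>n. vanishes_from \<xi> n \<longrightarrow>
        dual_rep N S \<xi> = dual_rep_sum N S n \<xi>) \<and>
     dual_rep N S \<in> hom (dual_group N) unitary_group \<and>
     endomorphism_ops (cuntz_endo N S) \<and>
     (\<forall>\<xi>\<in>carrier (dual_group N).
        cuntz_endo N S (dual_rep N S \<xi>) = dual_rep N S (dual_shift \<xi>)) \<and>
     (\<forall>P. pvm (word_borel N) P \<and> extends_cylinders N S P \<longrightarrow>
        (\<forall>\<xi>\<in>carrier (dual_group N).
           dual_rep N S \<xi> = pvm_integral (word_borel N) P (\<lambda>\<omega>. pairing N \<omega> \<xi>)) \<and>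
        (\<forall>i<N. \<forall>A\<in>sets (word_borel N).
           S i o\<^sub>L P A o\<^sub>L adj (S i) = P (branch i ` A)) \<and>
        (\<forall>A\<in>sets (word_borel N).
           (\<Sum>j<N. S j o\<^sub>L P (branch j -` A \<inter> inf_words N) o\<^sub>L adj (S j)) = P A) \<and>
        (\<forall>A\<in>sets (word_borel N).
           cuntz_endo N S (P A) = P (shift -` A \<inter> inf_words N)) \<and>
        (\<forall>f :: (nat \<Rightarrow> nat) \<Rightarrow> complex.
           f \<in> borel_measurable (word_borel N) \<and> bounded (f ` inf_words N) \<longrightarrow>
           cuntz_endo N S (pvm_integral (word_borel N) P f) =
             pvm_integral (word_borel N) P (\<lambda>\<omega>. f (shift \<omega>))))"
proof -
  interpret cuntz_representation N S using assms by unfold_locales auto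
  obtain P0 where P0: "pvm (word_borel N) P0" "extends_cylinders N S P0" using pvm_exists by blast
  then interpret P0: cuntz_pvm N S P0 by unfold_locales
  show ?thesis
  proof (intro conjI allI impI ballI; (elim conjE)?)
    fix P :: "(nat \<Rightarrow> nat) set \<Rightarrow> ('a \<Rightarrow>\<^sub>L 'a)"
    assume "pvm (word_borel N) P" "extends_cylinders N S P"
    then interpret cuntz_pvm N S P by unfold_locales
    show "dual_rep N S \<xi> = pvm_integral (word_borel N) P (\<lambda>\<omega>. pairing N \<omega> \<xi>)"
      if "\<xi> \<in> carrier (dual_group N)" for \<xi>
      using pvm_integral_eqI[OF has_pvm_integral_dual_rep[OF that]] by simp
    show "S i o\<^sub>L P A o\<^sub>L adj (S i) = P (branch i ` A)" if "i < N" "A \<in> sets (word_borel N)" for i A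
      using that by (rule covariance)
    show "(\<Sum>j<N. S j o\<^sub>L P (branch j -` A \<inter> inf_words N) o\<^sub>L adj (S j)) = P A"
      if "A \<in> sets (word_borel N)" for A
      using that by (rule sum_branch_preimages)
    show "cuntz_endo N S (P A) = P (shift -` A \<inter> inf_words N)" if "A \<in> sets (word_borel N)" for A
      using that by (rule endo_P)
    show "cuntz_endo N S (pvm_integral (word_borel N) P f) = pvm_integral (word_borel N) P (\<lambda>\<omega>. f (shift \<omega>))"
      if "f \<in> borel_measurable (word_borel N)" "bounded (f ` inf_words N)" for f
      using that by (rule endo_pvm_integral)
  qed (use P0 P0.dual_rep_eq_sum P0.dual_rep_hom P0.endo_dual_rep endomorphism_cuntz_endo in auto)
qed

end
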